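(* Let $f$ be admissible and let $\mathfrak L$ be the liquid region (see context). Let $\mathcal K\subset\mathfrak L$ be a compact set. There exist positive constants $N_{\mathcal K}$ and $C_{\mathcal K}>1$ such that $$\frac{1}{n+1}\,\frac{1}{C_{\mathcal K}}\le\left|d\widetilde{\mathcal T}_n(e_{\iota,\iota'}(j,k))\right|\le\frac{1}{n+1}\,C_{\mathcal K}$$ for all $n>N_{\mathcal K}$ and all edges $e_{\iota,\iota'}(j,k)$ of the dual graph with $\frac{1}{n+1}e_{\iota,\iota'}(j,k)\subset\mathcal K$.
   Context: **Admissible functions.** $f:\mathbb{R}\to\mathbb{R}$ is admissible if $f(-1)=1$, there is a smallest $x_*>-1$ with $f(x_* )=x_*$, and $|f'(x)|\le1$ for all $x\in[-1,x_*]$. Set $\bar f(x)=-x$ for $x<-1$, $\bar f(x)=f(x)$ for $x\in[-1,x_*]$, $\bar f(x)=x$ for $x>x_*$. **Up-down paths.** An up-down path is $H:\mathbb{Z}\to\mathbb{Z}$ with $H(c+1)-H(c)=\pm1$, interpolated linearly to $\mathbb{R}$; here we use those with $H(c)+c$ odd for all $c$. $H^f_n$ is the (pointwise) largest such path with $\frac{1}{n+1}\left(H_n^f((n+1)x)+1\right)\le\bar f(x)$ for all $x\in\mathbb{R}$. It records the number of faces in each column $c=j+k$ of the generalized tower graph of rank $n$ approximating $f$, whose faces are labelled by $(j,k)\in\mathbb{Z}^2$. **Aztec t-embedding.** Let $\mathcal T_n(j,k)=F(j,k,n)$ ($j+k+n$ odd), where $F$ is the unique solution of: $F(j,k,n)=0$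 if $|j|+|k|\ge n$; $F(0,0,1)=0$; for $n\ge1$, $F(n,0,n+1)=\frac12(F(n-1,0,n)+1)$, $F(0,n,n+1)=\frac12(F(0,n-1,n)+i)$, $F(-n,0,n+1)=\frac12(F(-n+1,0,n)-1)$, $F(0,-n,n+1)=\frac12(F(0,-n+1,n)-i)$; and for all other $|j|+|k|\le n$, $F(j,k,n+1)+F(j,k,n-1)=\frac12\left(F(j+1,k,n)+F(j-1,k,n)+F(j,k+1,n)+F(j,k-1,n)\right)$. **The t-embedding $\widetilde{\mathcal T}_n$.** The perfect t-embedding of the reduced generalized tower graph of rank $n+1$ approximating $f$ takes at the face $(j,k)$ the value $\widetilde{\mathcal T}_n(j,k)=\mathcal T_r(j,k)$ with $r=r(n;j,k):=H^f_{n+1}(j+k)$. **Edges.** The faces $(j,k)$ and $(j+\iota,k+\iota')$ are joined by a dual edge $e_{\iota,\iota'}(j,k)$ when $(\iota,\iota')\in\{(\pm1,0),(0,\pm1)\}$, and also when $(\iota,\iota')\in\{(1,-1),(-1,1)\}$ if column $c=j+k$ consists of hexagons (i.e. $H^f_{n+1}(c-1),H^f_{n+1}(c),H^f_{n+1}(c+1)$ is monotone). One has $d\widetilde{\mathcal T}_n(e_{\iota,\iota'}(j,k))=\pm\left(\widetilde{\mathcal T}_n(j+\iota,k+\iota')-\widetilde{\mathcal T}_n(j,k)\right)$, the sign depending on an orientation. $\frac{1}{n+1}e_{\iota,\iota'}(j,k)$ denotes the segment from $\frac{1}{n+1}(j,k)$ to $\frac1{n+1}(j+\iota,k+\iota')$.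 **Liquid region.** $\mathfrak L$ is the set of $(x,y)\in\mathbb{R}^2$ with $-1<x+y<x_*$, $|x-y|<f(x+y)$ and $2(x^2+y^2)<f(x+y)^2$. *)

theory Defs
  imports "HOL-Analysis.Analysis"
begin

definition smallest_fixpoint :: "(real \<Rightarrow> real) \<Rightarrow> real \<Rightarrow> bool" where
  "smallest_fixpoint f xs \<longleftrightarrow>
     -1 < xs \<and> f xs = xs \<and> (\<forall>x. -1 < x \<and> f x = x \<longrightarrow> xs \<le> x)"

definition x_star :: "(real \<Rightarrow> real) \<Rightarrow> real" where
  "x_star f = (THE xs. smallest_fixpoint f xs)"

definition admissible :: "(real \<Rightarrow> real) \<Rightarrow> bool" where
  "admissible f \<longleftrightarrow>
     f (-1) = 1 \<and>
     (\<exists>xs. smallest_fixpoint f xs) \<and>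
     (\<forall>x\<in>{-1..x_star f}. f differentiable (at x) \<and> \<bar>deriv f x\<bar> \<le> 1)"

lemma x_star_eq: "smallest_fixpoint f xs \<Longrightarrow> x_star f = xs"
  unfolding x_star_def
  by (rule the_equality) (auto simp: smallest_fixpoint_def intro: order.antisym)

definition fbar :: "(real \<Rightarrow> real) \<Rightarrow> real \<Rightarrow> real" where
  "fbar f x = (if x < -1 then - x else if x \<le> x_star f then f x else x)"

definition up_down_path :: "(int \<Rightarrow> int) \<Rightarrow> bool" where
  "up_down_path H \<longleftrightarrow>
     (\<forall>c. H (c + 1) - H c = 1 \<or> H (c + 1) - H c = -1) \<and> (\<forall>c. odd (H c + c))"

definition path_interp :: "(int \<Rightarrow> int) \<Rightarrow> real \<Rightarrow> real" where
  "path_interp H t = of_int (H \<lfloor>t\<rfloor>) + frac t * of_int (H (\<lfloor>t\<rfloor> + 1) - H \<lfloor>t\<rfloor>)"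

definition path_below :: "(real \<Rightarrow> real) \<Rightarrow> nat \<Rightarrow> (int \<Rightarrow> int) \<Rightarrow> bool" where
  "path_below f n H \<longleftrightarrow>
     (\<forall>x::real. 1 / (real n + 1) * (path_interp H ((real n + 1) * x) + 1) \<le> fbar f x)"

text \<open>The order on functions is pointwise. For admissible \<open>f\<close> a greatest path exists: pointwise
  maxima of up-down paths of the given parity are again such paths, \<open>fbar f\<close> bounds them from
  above, and \<open>\<lambda>c. \<bar>c\<bar> - 1\<close> qualifies because \<open>fbar f x \<ge> \<bar>x\<bar>\<close>.\<close>

definition tower_path :: "(real \<Rightarrow> real) \<Rightarrow> nat \<Rightarrow> int \<Rightarrow> int" where
  "tower_path f n = (GREATEST H. up_down_path H \<and> path_below f n H)"

text \<open>The third argument is the rank. Only arguments with \<open>odd (j + k + int n)\<close> are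
  meaningful. The lemmas below show that on these \<open>aztec_F\<close> is the unique solution of the
  defining recurrence.\<close>

fun aztec_F :: "int \<Rightarrow> int \<Rightarrow> nat \<Rightarrow> complex" where
  "aztec_F j k 0 = 0"
| "aztec_F j k (Suc 0) = 0"
| "aztec_F j k (Suc (Suc m)) =
     (let n = int m + 1 in
      if \<bar>j\<bar> + \<bar>k\<bar> > n then 0
      else if (j, k) = (n, 0) then (aztec_F (n - 1) 0 (Suc m) + 1) / 2
      else if (j, k) = (0, n) then (aztec_F 0 (n - 1) (Suc m) + \<i>) / 2
      else if (j, k) = (- n, 0) then (aztec_F (- n + 1) 0 (Suc m) - 1) / 2
      else if (j, k) = (0, - n) then (aztec_F 0 (- n + 1) (Suc m) - \<i>) / 2
      else (aztec_F (j + 1) k (Suc m) + aztec_F (j - 1) k (Suc m)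
            + aztec_F j (k + 1) (Suc m) + aztec_F j (k - 1) (Suc m)) / 2 - aztec_F j k m)"

definition aztec_recurrence :: "(int \<Rightarrow> int \<Rightarrow> nat \<Rightarrow> complex) \<Rightarrow> bool" where
  "aztec_recurrence F \<longleftrightarrow>
     (\<forall>j k n. odd (j + k + int n) \<and> \<bar>j\<bar> + \<bar>k\<bar> \<ge> int n \<longrightarrow> F j k n = 0) \<and>
     F 0 0 1 = 0 \<and>
     (\<forall>n\<ge>1. F (int n) 0 (n + 1) = (F (int n - 1) 0 n + 1) / 2 \<and>
            F 0 (int n) (n + 1) = (F 0 (int n - 1) n + \<i>) / 2 \<and>
            F (- int n) 0 (n + 1) = (F (- int n + 1) 0 n - 1) / 2 \<and>
            F 0 (- int n) (n + 1) = (F 0 (- int n + 1) n - \<i>) / 2 \<and>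
            (\<forall>j k. odd (j + k + int (n + 1)) \<and> \<bar>j\<bar> + \<bar>k\<bar> \<le> int n \<and>
                   (j, k) \<notin> {(int n, 0), (0, int n), (- int n, 0), (0, - int n)} \<longrightarrow>
               F j k (n + 1) + F j k (n - 1) =
                 (F (j + 1) k n + F (j - 1) k n + F j (k + 1) n + F j (k - 1) n) / 2))"

lemma aztec_recurrence_aztec_F: "aztec_recurrence aztec_F"
proof -
  have zero: "aztec_F j k n = 0" if "\<bar>j\<bar> + \<bar>k\<bar> \<ge> int n" for j k n
    using that by (cases "(j, k, n)" rule: aztec_F.cases) (auto simp: Let_def)
  show ?thesis
    unfolding aztec_recurrence_def
  proof (intro conjI allI impI, goal_cases)
    case (1 j k n)
    then show ?case using zero by blast
  next
    case 2
    then show ?case by simp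
  next
    case (3 n)
    then obtain m where "n = Suc m" by (cases n) auto
    then show ?case by (simp add: Let_def add.commute)
  next
    case (4 n)
    then obtain m where "n = Suc m" by (cases n) auto
    then show ?case by (simp add: Let_def add.commute)
  next
    case (5 n)
    then obtain m where "n = Suc m" by (cases n) auto
    then show ?case by (simp add: Let_def add.commute)
  next
    case (6 n)
    then obtain m where "n = Suc m" by (cases n) auto
    then show ?case by (simp add: Let_def add.commute)
  next
    case (7 n j k)
    then obtain m where "n = Suc m" by (cases n) auto
    with 7 have "\<not> \<bar>j\<bar> + \<bar>k\<bar> > int m + 1" "(j, k) \<noteq> (int m + 1, 0)" "(j, k) \<noteq> (0, int m + 1)"
      "(j, k) \<noteq> (- (int m + 1), 0)" "(j, k) \<noteq> (0, - (int m + 1))"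
      by (auto simp: add.commute)
    then show ?case
      unfolding \<open>n = Suc m\<close> by (simp only: Suc_eq_plus1[symmetric] aztec_F.simps Let_def if_False) simp
  qed
qed

lemma aztec_recurrence_unique:
  assumes F: "aztec_recurrence F" and "odd (j + k + int n)"
  shows "F j k n = aztec_F j k n"
  using assms(2)
proof (induction j k n rule: aztec_F.induct)
  case (1 j k)
  then show ?case using F by (auto simp: aztec_recurrence_def)
next
  case (2 j k)
  then show ?case
    using F unfolding aztec_recurrence_def
    by (cases "j = 0 \<and> k = 0") (simp, smt (verit) One_nat_def aztec_F.simps(2) of_nat_1)
next
  case (3 j k m)
  define n where "n = Suc m"
  note rec = F[unfolded aztec_recurrence_def]
  have n: "n \<ge> 1" "int n = int m + 1" "Suc (Suc m) = n + 1" "n - 1 = m"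
    by (auto simp: n_def)
  have corner: "F (int n) 0 (n + 1) = (F (int n - 1) 0 n + 1) / 2"
    "F 0 (int n) (n + 1) = (F 0 (int n - 1) n + \<i>) / 2"
    "F (- int n) 0 (n + 1) = (F (- int n + 1) 0 n - 1) / 2"
    "F 0 (- int n) (n + 1) = (F 0 (- int n + 1) n - \<i>) / 2"
    using rec n(1) by blast+
  consider "\<bar>j\<bar> + \<bar>k\<bar> > int n" | "(j, k) = (int n, 0)" | "(j, k) = (0, int n)"
    | "(j, k) = (- int n, 0)" | "(j, k) = (0, - int n)"
    | "\<bar>j\<bar> + \<bar>k\<bar> \<le> int n"
      "(j, k) \<notin> {(int n, 0), (0, int n), (- int n, 0), (0, - int n)}"
    by fastforce
  then show ?case
  proof cases
    case 1
    then have "\<bar>j\<bar> + \<bar>k\<bar> \<ge> int (Suc (Suc m))" using n by simp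
    then have "F j k (Suc (Suc m)) = 0" using rec "3.prems" by blast
    then show ?thesis using 1 by (simp add: Let_def n_def)
  next
    case 2
    then have "F (int n - 1) 0 n = aztec_F (int n - 1) 0 n"
      using "3.IH"(1)[OF n(2)] "3.prems" by (auto simp: n_def)
    then show ?thesis using 2 corner(1) by (auto simp: Let_def n_def add.commute)
  next
    case 3
    then have "F 0 (int n - 1) n = aztec_F 0 (int n - 1) n"
      using "3.IH"(2)[OF n(2)] "3.prems" by (auto simp: n_def)
    then show ?thesis using 3 corner(2) by (auto simp: Let_def n_def add.commute)
  next
    case 4
    then have "F (- int n + 1) 0 n = aztec_F (- int n + 1) 0 n"
      using "3.IH"(3)[OF n(2)] "3.prems" by (auto simp: n_def)
    then show ?thesis using 4 corner(3) by (auto simp: Let_def n_def add.commute)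
  next
    case 5
    then have "F 0 (- int n + 1) n = aztec_F 0 (- int n + 1) n"
      using "3.IH"(4)[OF n(2)] "3.prems" by (auto simp: n_def)
    then show ?thesis using 5 corner(4) by (auto simp: Let_def n_def add.commute)
  next
    case 6
    have ne: "\<not> \<bar>j\<bar> + \<bar>k\<bar> > int n" "(j, k) \<noteq> (int n, 0)" "(j, k) \<noteq> (0, int n)"
      "(j, k) \<noteq> (- int n, 0)" "(j, k) \<noteq> (0, - int n)"
      using 6 by auto
    have IH: "F (j + 1) k n = aztec_F (j + 1) k n" "F (j - 1) k n = aztec_F (j - 1) k n"
      "F j (k + 1) n = aztec_F j (k + 1) n" "F j (k - 1) n = aztec_F j (k - 1) n"
      "F j k m = aztec_F j k m"
      using "3.IH"(5-9)[OF n(2) ne] "3.prems" by (auto simp: n_def)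
    have "odd (j + k + int (n + 1))" using "3.prems" by (simp add: n_def)
    then have "F j k (n + 1) + F j k (n - 1) =
      (F (j + 1) k n + F (j - 1) k n + F j (k + 1) n + F j (k - 1) n) / 2"
      using rec 6 n(1) by blast
    moreover have "aztec_F j k (n + 1) + aztec_F j k (n - 1) =
      (aztec_F (j + 1) k n + aztec_F (j - 1) k n + aztec_F j (k + 1) n + aztec_F j (k - 1) n) / 2"
      using aztec_recurrence_aztec_F 6 n(1) \<open>odd (j + k + int (n + 1))\<close>
      unfolding aztec_recurrence_def by blast
    ultimately show ?thesis unfolding n(3) using IH n(4) by (metis add_right_cancel)
  qed
qed

text \<open>The rank \<open>tower_path f (n + 1) (j + k)\<close> is at least \<open>\<bar>j + k\<bar> - 1\<close>; if it equals \<open>-1\<close>, then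
  \<open>nat\<close> makes it \<open>0\<close>, where \<open>aztec_F\<close> vanishes, as it does for every rank \<open>\<le> \<bar>j\<bar> + \<bar>k\<bar>\<close>.\<close>

definition tower_T :: "(real \<Rightarrow> real) \<Rightarrow> nat \<Rightarrow> int \<Rightarrow> int \<Rightarrow> complex" where
  "tower_T f n j k = aztec_F j k (nat (tower_path f (n + 1) (j + k)))"

definition hexagon_column :: "(real \<Rightarrow> real) \<Rightarrow> nat \<Rightarrow> int \<Rightarrow> bool" where
  "hexagon_column f n c \<longleftrightarrow>
     (let H = tower_path f (n + 1) in
      (H (c - 1) \<le> H c \<and> H c \<le> H (c + 1)) \<or> (H (c - 1) \<ge> H c \<and> H c \<ge> H (c + 1)))"

text \<open>Faces are labelled by all of \<open>\<int>\<^sup>2\<close>; those of the graph in column \<open>c\<close> satisfy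
  \<open>\<bar>j - k\<bar> < tower_path f (n + 1) c\<close>. No such restriction is imposed on edges: it holds
  automatically for the edges whose rescaling lies in a fixed compact subset of the liquid region,
  once \<open>n\<close> is large.\<close>

definition dual_edge :: "(real \<Rightarrow> real) \<Rightarrow> nat \<Rightarrow> int \<Rightarrow> int \<Rightarrow> int \<Rightarrow> int \<Rightarrow> bool" where
  "dual_edge f n \<iota> \<iota>' j k \<longleftrightarrow>
     (\<iota>, \<iota>') \<in> {(1, 0), (-1, 0), (0, 1), (0, -1)} \<or>
     (\<iota>, \<iota>') \<in> {(1, -1), (-1, 1)} \<and> hexagon_column f n (j + k)"

text \<open>The increment along an edge in the orientation starting at \<open>(j, k)\<close>; the reverse orientation
  changes its sign, so its modulus does not depend on the choice.\<close>

definition d_tower_T :: "(real \<Rightarrow> real) \<Rightarrow> nat \<Rightarrow> int \<Rightarrow> int \<Rightarrow> int \<Rightarrow> int \<Rightarrow> complex" where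
  "d_tower_T f n \<iota> \<iota>' j k = tower_T f n (j + \<iota>) (k + \<iota>') - tower_T f n j k"

definition scaled_edge :: "nat \<Rightarrow> int \<Rightarrow> int \<Rightarrow> int \<Rightarrow> int \<Rightarrow> (real \<times> real) set" where
  "scaled_edge n \<iota> \<iota>' j k =
     closed_segment ((1 / (real n + 1)) *\<^sub>R (of_int j, of_int k))
                    ((1 / (real n + 1)) *\<^sub>R (of_int (j + \<iota>), of_int (k + \<iota>')))"

definition liquid_region :: "(real \<Rightarrow> real) \<Rightarrow> (real \<times> real) set" where
  "liquid_region f =
     {(x, y). -1 < x + y \<and> x + y < x_star f \<and> \<bar>x - y\<bar> < f (x + y) \<and>
              2 * (x\<^sup>2 + y\<^sup>2) < (f (x + y))\<^sup>2}"

end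

theory Submission
  imports Defs
begin

text \<open>Put \<open>a = (j + k + N) / 2\<close>, \<open>b = (j - k + N) / 2\<close> with \<open>N = n - 1\<close>, and let \<open>c(a, b)\<close> be the coefficient
  of \<open>z\<^sup>a\<close> in \<open>(1 + z)\<^bsup>N - b\<^esup> (1 - z)\<^sup>b\<close>. The increments of \<open>F(j, k, n)\<close> along the directions
  \<open>(\<plusminus>1, 0, 1)\<close>, \<open>(0, \<plusminus>1, 1)\<close> factor as products of a Coulomb gauge function
  \<open>c(a, b) - i c(a + 1, b)\<close> on black vertices and one \<open>2\<^bsup>-N-1\<^esup> (c(b, a) + i c(b + 1, a))\<close> on white
  vertices, because the wave equation for \<open>F\<close> turns into Pascal's rule for each factor; the
  diagonals of hexagon columns are twice such a product. So an edge length is governed by the sums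
  of squares \<open>c(a, b)\<^sup>2 + c(a + 1, b)\<^sup>2\<close>, in which the oscillations of the Krawtchouk coefficients
  cannot cancel: inside the disk \<open>2 (j\<^sup>2 + k\<^sup>2) < N\<^sup>2\<close> a Sonin-type quadratic form in \<open>c(a, b)\<close>,
  \<open>c(a + 1, b)\<close> is positive definite, and after division by a binomial coefficient it changes only
  by a factor \<open>1 + O(1/N)\<close> per step in \<open>a\<close>. Hence it is comparable to its value at \<open>a = N/2\<close>, where
  the coefficients are explicit. Finally the rank of a face is \<open>(n + 1) f(c / (n + 1)) + O(1)\<close>, so
  the faces lying over \<open>K\<close> fall into a disk that is smaller by a fixed factor.\<close>

section \<open>Krawtchouk coefficients\<close>

text \<open>Coefficient of \<open>z ^ a\<close> in \<open>(1 + z) ^ p * (1 - z) ^ q\<close>; each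
  recursive equation multiplies by one factor. The index is an integer so that \<open>a - 1\<close>
  makes sense at the border, where the value is 0.\<close>

fun krawtchouk :: "nat \<Rightarrow> nat \<Rightarrow> int \<Rightarrow> real" where
  "krawtchouk 0 0 a = (if a = 0 then 1 else 0)"
| "krawtchouk 0 (Suc q) a = krawtchouk 0 q a - krawtchouk 0 q (a - 1)"
| "krawtchouk (Suc p) q a = krawtchouk p q a + krawtchouk p q (a - 1)"

text \<open>The factors commute, so a factor \<open>1 - z\<close> can be split off also when
  \<open>p > 0\<close>.\<close>

lemma krawtchouk_Suc_right: "krawtchouk p (Suc q) a = krawtchouk p q a - krawtchouk p q (a - 1)"
  by (induction p arbitrary: a) auto

lemma krawtchouk_neg: "a < 0 \<Longrightarrow> krawtchouk p q a = 0"
  by (induction p q a rule: krawtchouk.induct) auto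

lemma krawtchouk_large: "a > int (p + q) \<Longrightarrow> krawtchouk p q a = 0"
  by (induction p q a rule: krawtchouk.induct) auto

text \<open>The product \<open>G = (1 + z) ^ p * (1 - z) ^ q\<close> solves
  \<open>(1 - z ^ 2) * G' = (p - q - (p + q) * z) * G\<close>; this compares the coefficients of
  \<open>z ^ a\<close>. The induction combines the instances at \<open>a\<close> and
  \<open>a - 1\<close>.\<close>

lemma krawtchouk_recurrence:
  "(of_int a + 1) * krawtchouk p q (a + 1)
     = (real p - real q) * krawtchouk p q a - (real (p + q) - of_int a + 1) * krawtchouk p q (a - 1)"
proof (induction p q a rule: krawtchouk.induct)
  case (1 a)
  then show ?case by (auto simp: add_eq_0_iff)
next
  case (2 q a)
  have "of_int a * krawtchouk 0 q a
    = (0 - real q) * krawtchouk 0 q (a - 1) - (real q - of_int a + 2) * krawtchouk 0 q (a - 2)"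
    using 2(2) by simp
  then show ?case using 2(1) by (simp add: algebra_simps)
next
  case (3 p q a)
  have "of_int a * krawtchouk p q a
    = (real p - real q) * krawtchouk p q (a - 1) - (real (p + q) - of_int a + 2) * krawtchouk p q (a - 2)"
    using 3(2) by simp
  then show ?case using 3(1) by (simp add: algebra_simps)
qed

text \<open>Substituting \<open>1 / z\<close> for \<open>z\<close> and multiplying by
  \<open>z ^ (p + q)\<close> changes only the factors \<open>1 - z\<close>, each by a sign.\<close>

lemma krawtchouk_reflect: "krawtchouk p q (int (p + q) - a) = (-1) ^ q * krawtchouk p q a"
proof (induction p q a rule: krawtchouk.induct)
  case (2 q a)
  have "krawtchouk 0 q (int q - a) = (-1) ^ q * krawtchouk 0 q a" using 2(1) by simp
  moreover have "krawtchouk 0 q (int q - a + 1) = (-1) ^ q * krawtchouk 0 q (a - 1)"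
    using 2(2) by (simp add: algebra_simps)
  ultimately show ?case by (simp add: algebra_simps)
next
  case (3 p q a)
  have "krawtchouk p q (int p + int q - a) = (-1) ^ q * krawtchouk p q a" using 3(1) by simp
  moreover have "krawtchouk p q (int p + int q - a + 1) = (-1) ^ q * krawtchouk p q (a - 1)"
    using 3(2) by (simp add: algebra_simps)
  ultimately show ?case by (simp add: algebra_simps)
qed auto

lemma krawtchouk_0: "krawtchouk p q 0 = 1"
  by (induction p q "0::int" rule: krawtchouk.induct) (auto simp: krawtchouk_neg)

lemma krawtchouk_top: "krawtchouk p q (int (p + q)) = (-1) ^ q"
  using krawtchouk_reflect[of p q 0] by (simp add: krawtchouk_0)

section \<open>Factorization of the increments\<close>

text \<open>The embedding of rank \<open>N + 1\<close> in the coordinates \<open>0 \<le> a, b \<le> N\<close>, in which the four upward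
  neighbours of \<open>(a, b, N)\<close> are \<open>(a + s, b + t, N + 1)\<close> with \<open>s, t \<in> {0, 1}\<close>.\<close>

definition grid_F :: "nat \<Rightarrow> nat \<Rightarrow> nat \<Rightarrow> complex" where
  "grid_F N a b = aztec_F (int a + int b - int N) (int a - int b) (Suc N)"

section \<open>The wave equation in grid coordinates\<close>

lemma aztec_F_zero: "\<bar>j\<bar> + \<bar>k\<bar> \<ge> int n \<Longrightarrow> aztec_F j k n = 0"
  by (cases "(j, k, n)" rule: aztec_F.cases) (auto simp: Let_def)

lemma grid_F_0: "grid_F 0 0 0 = 0"
  by (simp add: grid_F_def)

lemma grid_F_corner:
  "grid_F (Suc N) (Suc N) (Suc N) = (grid_F N N N + 1) / 2"
  "grid_F (Suc N) (Suc N) 0 = (grid_F N N 0 + \<i>) / 2"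
  "grid_F (Suc N) 0 0 = (grid_F N 0 0 - 1) / 2"
  "grid_F (Suc N) 0 (Suc N) = (grid_F N 0 N - \<i>) / 2"
  by (auto simp: grid_F_def Let_def)

lemma aztec_F_step:
  assumes "\<bar>j\<bar> + \<bar>k\<bar> \<le> int N + 1" "j \<noteq> 0 \<or> \<bar>k\<bar> \<noteq> int N + 1" "k \<noteq> 0 \<or> \<bar>j\<bar> \<noteq> int N + 1"
  shows "aztec_F j k (Suc (Suc N)) = (aztec_F (j + 1) k (Suc N) + aztec_F (j - 1) k (Suc N)
            + aztec_F j (k + 1) (Suc N) + aztec_F j (k - 1) (Suc N)) / 2 - aztec_F j k N"
proof -
  have "\<not> \<bar>j\<bar> + \<bar>k\<bar> > int N + 1" "(j, k) \<noteq> (int N + 1, 0)" "(j, k) \<noteq> (0, int N + 1)"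
    "(j, k) \<noteq> (- (int N + 1), 0)" "(j, k) \<noteq> (0, - (int N + 1))"
    using assms by auto
  then show ?thesis by (simp only: aztec_F.simps Let_def if_False)
qed

lemma grid_F_interior:
  assumes "a \<le> N" "b \<le> N"
  shows "grid_F (Suc (Suc N)) (Suc a) (Suc b) =
    (grid_F (Suc N) (Suc a) (Suc b) + grid_F (Suc N) a (Suc b)
      + grid_F (Suc N) (Suc a) b + grid_F (Suc N) a b) / 2 - grid_F N a b"
  unfolding grid_F_def
  by (subst aztec_F_step) (use assms in \<open>auto simp: algebra_simps\<close>)

text \<open>Along a side of the diamond two of the four neighbours and the face two ranks below lie
  where \<open>aztec_F\<close> is 0, so the rule becomes a mean of two values.\<close>

lemma grid_F_side:
  assumes "b < N"
  shows "grid_F (Suc N) (Suc N) (Suc b) = (grid_F N N (Suc b) + grid_F N N b) / 2"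
    and "grid_F (Suc N) 0 (Suc b) = (grid_F N 0 (Suc b) + grid_F N 0 b) / 2"
    and "grid_F (Suc N) (Suc b) (Suc N) = (grid_F N (Suc b) N + grid_F N b N) / 2"
    and "grid_F (Suc N) (Suc b) 0 = (grid_F N (Suc b) 0 + grid_F N b 0) / 2"
proof (unfold grid_F_def, goal_cases)
  case 1
  show ?case by (subst aztec_F_step) (use assms in \<open>auto simp: algebra_simps aztec_F_zero\<close>)
next
  case 2
  show ?case by (subst aztec_F_step) (use assms in \<open>auto simp: algebra_simps aztec_F_zero\<close>)
next
  case 3
  show ?case by (subst aztec_F_step) (use assms in \<open>auto simp: algebra_simps aztec_F_zero\<close>)
next
  case 4
  show ?case by (subst aztec_F_step) (use assms in \<open>auto simp: algebra_simps aztec_F_zero\<close>)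
qed

section \<open>The two gauge functions\<close>

definition gauge_b :: "nat \<Rightarrow> int \<Rightarrow> nat \<Rightarrow> complex" where
  "gauge_b N a b = Complex (krawtchouk (N - b) b a) (- krawtchouk (N - b) b (a + 1))"

text \<open>The roles of \<open>a\<close> and \<open>b\<close> are exchanged with respect to
  \<open>gauge_b\<close>. In both functions the integer argument is the index of a coefficient and
  reaches -1 on the border, while the second natural number counts the factors
  \<open>1 - z\<close>.\<close>

definition gauge_w :: "nat \<Rightarrow> nat \<Rightarrow> int \<Rightarrow> complex" where
  "gauge_w N a b = Complex (krawtchouk (N - a) a b) (krawtchouk (N - a) a (b + 1)) / 2 ^ Suc N"

text \<open>Pascal's rule: raising \<open>N\<close> alone adds a factor \<open>1 + z\<close>;
  raising the count of the factors \<open>1 - z\<close> along with it adds one of those.\<close>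

lemma gauge_b_Suc: "b \<le> N \<Longrightarrow> gauge_b (Suc N) a b = gauge_b N a b + gauge_b N (a - 1) b"
  by (simp add: gauge_b_def Suc_diff_le complex_eq_iff)

lemma gauge_b_Suc_Suc: "gauge_b (Suc N) a (Suc b) = gauge_b N a b - gauge_b N (a - 1) b"
  by (simp add: gauge_b_def krawtchouk_Suc_right complex_eq_iff)

lemma gauge_w_Suc: "a \<le> N \<Longrightarrow> gauge_w (Suc N) a b = (gauge_w N a b + gauge_w N a (b - 1)) / 2"
  by (simp add: gauge_w_def Suc_diff_le complex_eq_iff field_simps)

lemma gauge_w_Suc_Suc: "gauge_w (Suc N) (Suc a) b = (gauge_w N a b - gauge_w N a (b - 1)) / 2"
  by (simp add: gauge_w_def krawtchouk_Suc_right complex_eq_iff field_simps)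

text \<open>At the border one of the two adjacent coefficients lies outside the polynomial and the
  other is an end coefficient, \<open>(-1) ^ b\<close> or 1.\<close>

lemma gauge_b_boundary:
  assumes "b \<le> N"
  shows "gauge_b N (int N) b = (-1) ^ b" "gauge_b N (-1) b = - \<i>"
  using assms krawtchouk_top[of "N - b" b]
  by (auto simp: gauge_b_def complex_eq_iff krawtchouk_large krawtchouk_neg krawtchouk_0 Re_power_real of_nat_diff)

lemma gauge_w_boundary:
  assumes "a \<le> N"
  shows "gauge_w N a (int N) = (-1) ^ a / 2 ^ Suc N" "gauge_w N a (-1) = \<i> / 2 ^ Suc N"
  using assms krawtchouk_top[of "N - a" a]
  by (auto simp: gauge_w_def complex_eq_iff krawtchouk_large krawtchouk_neg krawtchouk_0 Re_power_real of_nat_diff)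

lemma grid_F_corner_value:
  "grid_F N N N = 1 - 1 / 2 ^ N" "grid_F N N 0 = \<i> - \<i> / 2 ^ N"
  "grid_F N 0 0 = - 1 + 1 / 2 ^ N" "grid_F N 0 N = - \<i> + \<i> / 2 ^ N"
  by (induction N) (simp_all add: grid_F_0 grid_F_corner diff_divide_distrib add_divide_distrib)


text \<open>Induction on \<open>N\<close>, sorted by the upper face: an interior upper face yields
  all four increments that end there, a side face two, a corner one. The four statements go together
  because each new increment uses several old ones.\<close>

lemma grid_F_increment:
  assumes "a \<le> N" "b \<le> N"
  shows "grid_F (Suc N) (Suc a) (Suc b) - grid_F N a b = gauge_b N (int a) b * gauge_w N a (int b)"
    and "grid_F (Suc N) (Suc a) b - grid_F N a b = gauge_b N (int a) b * gauge_w N a (int b - 1)"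
    and "grid_F (Suc N) a b - grid_F N a b = - gauge_b N (int a - 1) b * gauge_w N a (int b - 1)"
    and "grid_F (Suc N) a (Suc b) - grid_F N a b = gauge_b N (int a - 1) b * gauge_w N a (int b)"
  using assms
proof (induction N arbitrary: a b)
  case 0
  {
    case 1 then show ?case
      by (simp add: grid_F_0 grid_F_corner gauge_b_def gauge_w_def complex_eq_iff)
  next
    case 2 then show ?case
      by (simp add: grid_F_0 grid_F_corner gauge_b_def gauge_w_def complex_eq_iff)
  next
    case 3 then show ?case
      by (simp add: grid_F_0 grid_F_corner gauge_b_def gauge_w_def complex_eq_iff)
  next
    case 4 then show ?case
      by (simp add: grid_F_0 grid_F_corner gauge_b_def gauge_w_def complex_eq_iff)
  }
next
  case (Suc N)
  define X where "X = grid_F (Suc N)"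
  define U where "U = grid_F (Suc (Suc N))"
  define f where "f = gauge_b N"
  define g where "g = gauge_w N"
  \<comment> \<open>By the induction hypothesis all four neighbours are \<open>L\<close> plus or
    minus a product. The wave equation then makes \<open>U - X a b\<close>, for instance, half of
    \<open>(f a + f (a - 1)) * (g b + g (b - 1))\<close>, with the other arguments suppressed, and
    Pascal's rule recognizes both factors.\<close>
  have inter: "U (Suc a) (Suc b) - X a b = gauge_b (Suc N) (int a) b * gauge_w (Suc N) a (int b)"
    "U (Suc a) (Suc b) - X a (Suc b) = gauge_b (Suc N) (int a) (Suc b) * gauge_w (Suc N) a (int b)"
    "U (Suc a) (Suc b) - X (Suc a) (Suc b) = - gauge_b (Suc N) (int a) (Suc b) * gauge_w (Suc N) (Suc a) (int b)"
    "U (Suc a) (Suc b) - X (Suc a) b = gauge_b (Suc N) (int a) b * gauge_w (Suc N) (Suc a) (int b)"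
    if ab: "a \<le> N" "b \<le> N" for a b
  proof -
    define L where "L = grid_F N a b"
    have X: "X (Suc a) (Suc b) = L + f (int a) b * g a (int b)"
      "X (Suc a) b = L + f (int a) b * g a (int b - 1)"
      "X a b = L - f (int a - 1) b * g a (int b - 1)"
      "X a (Suc b) = L + f (int a - 1) b * g a (int b)"
      using Suc.IH[OF ab] by (simp_all add: X_def L_def f_def g_def algebra_simps)
    have U: "U (Suc a) (Suc b) = (X (Suc a) (Suc b) + X a (Suc b) + X (Suc a) b + X a b) / 2 - L"
      using grid_F_interior[OF ab] by (simp add: X_def U_def L_def)
    note G = gauge_b_Suc[OF ab(2)] gauge_b_Suc_Suc gauge_w_Suc[OF ab(1)] gauge_w_Suc_Suc
    show "U (Suc a) (Suc b) - X a b = gauge_b (Suc N) (int a) b * gauge_w (Suc N) a (int b)"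
    "U (Suc a) (Suc b) - X a (Suc b) = gauge_b (Suc N) (int a) (Suc b) * gauge_w (Suc N) a (int b)"
    "U (Suc a) (Suc b) - X (Suc a) (Suc b) = - gauge_b (Suc N) (int a) (Suc b) * gauge_w (Suc N) (Suc a) (int b)"
    "U (Suc a) (Suc b) - X (Suc a) b = gauge_b (Suc N) (int a) b * gauge_w (Suc N) (Suc a) (int b)"
      unfolding U X G f_def[symmetric] g_def[symmetric] by (simp_all add: field_simps)
  qed
  \<comment> \<open>On a side \<open>U\<close> is the mean of two faces, so both increments are half
    of their difference up to sign. That difference is known because one gauge factor is explicit
    there; the other three sides are alike.\<close>
  have right: "U (Suc (Suc N)) (Suc b) - X (Suc N) b = gauge_b (Suc N) (int (Suc N)) b * gauge_w (Suc N) (Suc N) (int b)"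
    "U (Suc (Suc N)) (Suc b) - X (Suc N) (Suc b) = gauge_b (Suc N) (int (Suc N)) (Suc b) * gauge_w (Suc N) (Suc N) (int b)"
    if b: "b \<le> N" for b
  proof -
    have U: "U (Suc (Suc N)) (Suc b) = (X (Suc N) (Suc b) + X (Suc N) b) / 2"
      using grid_F_side(1)[of b "Suc N"] b by (simp add: X_def U_def)
    have X: "X (Suc N) (Suc b) = X (Suc N) b + (-1) ^ b * (g N (int b) - g N (int b - 1))"
      using Suc.IH(1,2)[of N b] b gauge_b_boundary(1)[of b N]
      by (simp add: X_def g_def algebra_simps)
    show "U (Suc (Suc N)) (Suc b) - X (Suc N) b = gauge_b (Suc N) (int (Suc N)) b * gauge_w (Suc N) (Suc N) (int b)"
      "U (Suc (Suc N)) (Suc b) - X (Suc N) (Suc b) = gauge_b (Suc N) (int (Suc N)) (Suc b) * gauge_w (Suc N) (Suc N) (int b)"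
      using b gauge_b_boundary(1)[of b "Suc N"] gauge_b_boundary(1)[of "Suc b" "Suc N"]
      unfolding U X gauge_w_Suc_Suc by (simp_all add: g_def field_simps)
  qed
  have left: "U 0 (Suc b) - X 0 b = gauge_b (Suc N) (-1) b * gauge_w (Suc N) 0 (int b)"
    "U 0 (Suc b) - X 0 (Suc b) = - gauge_b (Suc N) (-1) (Suc b) * gauge_w (Suc N) 0 (int b)"
    if b: "b \<le> N" for b
  proof -
    have U: "U 0 (Suc b) = (X 0 (Suc b) + X 0 b) / 2"
      using grid_F_side(2)[of b "Suc N"] b by (simp add: X_def U_def)
    have X: "X 0 (Suc b) = X 0 b - \<i> * (g 0 (int b) + g 0 (int b - 1))"
      using Suc.IH(3,4)[of 0 b] b gauge_b_boundary(2)[of b N]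
      by (simp add: X_def g_def algebra_simps)
    show "U 0 (Suc b) - X 0 b = gauge_b (Suc N) (-1) b * gauge_w (Suc N) 0 (int b)"
    "U 0 (Suc b) - X 0 (Suc b) = - gauge_b (Suc N) (-1) (Suc b) * gauge_w (Suc N) 0 (int b)"
      using b gauge_b_boundary(2)[of b "Suc N"] gauge_b_boundary(2)[of "Suc b" "Suc N"]
      unfolding U gauge_w_Suc[OF le0] X by (simp_all add: g_def field_simps)
  qed
  have upper: "U (Suc a) (Suc (Suc N)) - X a (Suc N) = gauge_b (Suc N) (int a) (Suc N) * gauge_w (Suc N) a (int (Suc N))"
    "U (Suc a) (Suc (Suc N)) - X (Suc a) (Suc N) = gauge_b (Suc N) (int a) (Suc N) * gauge_w (Suc N) (Suc a) (int (Suc N))"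
    if a: "a \<le> N" for a
  proof -
    have U: "U (Suc a) (Suc (Suc N)) = (X (Suc a) (Suc N) + X a (Suc N)) / 2"
      using grid_F_side(3)[of a "Suc N"] a by (simp add: X_def U_def)
    have X: "X (Suc a) (Suc N) = X a (Suc N) + (-1) ^ a / 2 ^ Suc N * (f (int a) N - f (int a - 1) N)"
      using Suc.IH(1,4)[of a N] a gauge_w_boundary(1)[of a N]
      by (simp add: X_def f_def field_simps)
    show "U (Suc a) (Suc (Suc N)) - X a (Suc N) = gauge_b (Suc N) (int a) (Suc N) * gauge_w (Suc N) a (int (Suc N))"
    "U (Suc a) (Suc (Suc N)) - X (Suc a) (Suc N) = gauge_b (Suc N) (int a) (Suc N) * gauge_w (Suc N) (Suc a) (int (Suc N))"
      using a unfolding U X gauge_b_Suc_Suc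
      by (simp_all only: gauge_w_boundary le_SucI Suc_le_mono) (simp_all add: f_def field_simps)
  qed
  have lower: "U (Suc a) 0 - X a 0 = gauge_b (Suc N) (int a) 0 * gauge_w (Suc N) a (-1)"
    "U (Suc a) 0 - X (Suc a) 0 = - gauge_b (Suc N) (int a) 0 * gauge_w (Suc N) (Suc a) (-1)"
    if a: "a \<le> N" for a
  proof -
    have U: "U (Suc a) 0 = (X (Suc a) 0 + X a 0) / 2"
      using grid_F_side(4)[of a "Suc N"] a by (simp add: X_def U_def)
    have X: "X (Suc a) 0 = X a 0 + \<i> / 2 ^ Suc N * (f (int a) 0 + f (int a - 1) 0)"
      using Suc.IH(2,3)[of a 0] a gauge_w_boundary(2)[of a N]
      by (simp add: X_def f_def field_simps)
    show "U (Suc a) 0 - X a 0 = gauge_b (Suc N) (int a) 0 * gauge_w (Suc N) a (-1)"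
    "U (Suc a) 0 - X (Suc a) 0 = - gauge_b (Suc N) (int a) 0 * gauge_w (Suc N) (Suc a) (-1)"
      using a unfolding U X gauge_b_Suc[OF le0]
      by (simp_all only: gauge_w_boundary le_SucI Suc_le_mono) (simp_all add: f_def field_simps)
  qed
  \<comment> \<open>At a corner both faces and both gauge factors are explicit.\<close>
  have corners:
    "U (Suc (Suc N)) (Suc (Suc N)) - X (Suc N) (Suc N) = gauge_b (Suc N) (int (Suc N)) (Suc N) * gauge_w (Suc N) (Suc N) (int (Suc N))"
    "U (Suc (Suc N)) 0 - X (Suc N) 0 = gauge_b (Suc N) (int (Suc N)) 0 * gauge_w (Suc N) (Suc N) (-1)"
    "U 0 0 - X 0 0 = - gauge_b (Suc N) (-1) 0 * gauge_w (Suc N) 0 (-1)"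
    "U 0 (Suc (Suc N)) - X 0 (Suc N) = gauge_b (Suc N) (-1) (Suc N) * gauge_w (Suc N) 0 (int (Suc N))"
    unfolding U_def X_def grid_F_corner_value
    by (simp_all only: gauge_b_boundary gauge_w_boundary order_refl le0)
       (simp_all add: field_simps power_mult_distrib[symmetric])
  {
    case 1
    then show ?case
      using inter(1)[of a b] right(1)[of b] upper(1)[of a] corners(1)
      by (cases "a = Suc N"; cases "b = Suc N") (simp_all add: U_def X_def)
  next
    \<comment> \<open>In the last three directions the upper face keeps a coordinate of the lower
      one, which has to be written as a successor; the value 0 belongs to a side or a
      corner.\<close>
    case 2
    then show ?case
      using inter(2)[of a "b - 1"] right(2)[of "b - 1"] lower(1)[of a] corners(2)
      by (cases "a = Suc N"; cases b) (simp_all add: U_def X_def)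
  next
    case 3
    then show ?case
      using inter(3)[of "a - 1" "b - 1"] left(2)[of "b - 1"] lower(2)[of "a - 1"] corners(3)
      by (cases a; cases b) (simp_all add: U_def X_def)
  next
    case 4
    then show ?case
      using inter(4)[of "a - 1" b] left(1)[of b] upper(2)[of "a - 1"] corners(4)
      by (cases a; cases "b = Suc N") (simp_all add: U_def X_def)
  }
qed

text \<open>Both faces are reached from \<open>(a, b)\<close> at level \<open>N\<close>; in the
  difference of the two increments Pascal's rule merges the white factors.\<close>

lemma grid_F_diagonal:
  assumes "a \<le> N" "b \<le> N"
  shows "grid_F (Suc N) (Suc a) (Suc b) - grid_F (Suc N) (Suc a) b
    = 2 * gauge_b N (int a) b * gauge_w (Suc N) (Suc a) (int b)"
  using grid_F_increment(1,2)[OF assms] by (simp add: gauge_w_Suc_Suc algebra_simps)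

section \<open>Energy estimates in the oscillatory region\<close>

definition kraw_norm :: "nat \<Rightarrow> nat \<Rightarrow> int \<Rightarrow> real" where
  "kraw_norm p q a = (krawtchouk p q a)\<^sup>2 + (krawtchouk p q (a + 1))\<^sup>2"

text \<open>Completing \<open>krawtchouk_recurrence\<close> to a nearly conserved quadratic form: its discriminant is
  negative exactly in the oscillatory region.\<close>

definition kraw_energy :: "nat \<Rightarrow> nat \<Rightarrow> nat \<Rightarrow> real" where
  "kraw_energy p q a =
     (real a + 1) * (krawtchouk p q (int a + 1))\<^sup>2
     - (real p - real q) * krawtchouk p q (int a) * krawtchouk p q (int a + 1)
     + (real (p + q) - real a) * (krawtchouk p q (int a))\<^sup>2"

text \<open>With \<open>j = a + b - N\<close> and \<open>k = a - b\<close> the left side is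
  \<open>2 * (j ^ 2 + k ^ 2)\<close>: this is the disk of the Aztec diamond of level
  \<open>N\<close>, with a relative margin \<open>\<delta>\<close>.\<close>

definition in_disk :: "real \<Rightarrow> nat \<Rightarrow> nat \<Rightarrow> nat \<Rightarrow> bool" where
  "in_disk \<delta> N a b \<longleftrightarrow> (2 * real a - real N)\<^sup>2 + (2 * real b - real N)\<^sup>2 \<le> (1 - \<delta>) * (real N)\<^sup>2"

lemma in_disk_commute: "in_disk \<delta> N a b \<longleftrightarrow> in_disk \<delta> N b a"
  by (simp add: in_disk_def add.commute)

text \<open>\<open>4 * a * (N - a) = N ^ 2 - (2 * a - N) ^ 2\<close>. With \<open>N = p + q\<close>
  and \<open>b = q\<close> the square on the left is \<open>(p - q) ^ 2\<close>, so this controls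
  the discriminant of \<open>kraw_energy\<close>.\<close>

lemma in_disk_product:
  assumes "in_disk \<delta> N a b"
  shows "\<delta> * (real N)\<^sup>2 + (2 * real b - real N)\<^sup>2 \<le> 4 * (real a * (real N - real a))"
  using assms by (simp add: in_disk_def power2_eq_square algebra_simps)

lemma in_disk_bounds:
  assumes "in_disk \<delta> N a b" "\<delta> > 0" "N > 0"
  shows "\<delta> / 4 * N \<le> real a" "\<delta> / 4 * N \<le> real N - real a" "\<delta> \<le> 1"
proof -
  have prod: "\<delta> * (real N)\<^sup>2 \<le> 4 * (real a * (real N - real a))"
    using in_disk_product[OF assms(1)] zero_le_power2[of "2 * real b - real N"] by linarith
  have pos: "\<delta> * (real N)\<^sup>2 > 0" using assms by simp
  have "real a * (real N - real a) > 0" using prod pos by linarith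
  then have a: "real a > 0" "real N - real a > 0"
    by (auto simp: zero_less_mult_iff)
  have "4 * (real a * (real N - real a)) \<le> 4 * (real a * real N)" using a by simp
  then have "(\<delta> * real N) * real N \<le> (4 * real a) * real N"
    using prod by (simp add: power2_eq_square)
  then show "\<delta> / 4 * N \<le> real a" using assms(3) by simp
  have "4 * (real a * (real N - real a)) \<le> 4 * (real N * (real N - real a))"
    using a by (intro mult_left_mono mult_right_mono) auto
  then have "(\<delta> * real N) * real N \<le> (4 * (real N - real a)) * real N"
    using prod by (simp add: power2_eq_square mult_ac)
  then show "\<delta> / 4 * N \<le> real N - real a" using assms(3) by simp
  have "0 \<le> (1 - \<delta>) * (real N)\<^sup>2"
    using assms(1) unfolding in_disk_def by (smt (verit) zero_le_power2)
  then show "\<delta> \<le> 1" using assms(3) by (simp add: zero_le_mult_iff)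
qed

lemma quadratic_form_nonneg:
  fixes \<alpha> \<beta> t x y :: real
  assumes "\<alpha> > 0" "t\<^sup>2 \<le> 4 * (\<alpha> * \<beta>)"
  shows "0 \<le> \<alpha> * x\<^sup>2 - t * y * x + \<beta> * y\<^sup>2"
proof -
  have "0 \<le> (2 * \<alpha> * x - t * y)\<^sup>2 + (4 * (\<alpha> * \<beta>) - t\<^sup>2) * y\<^sup>2" using assms by simp
  also have "\<dots> = 4 * \<alpha> * (\<alpha> * x\<^sup>2 - t * y * x + \<beta> * y\<^sup>2)"
    by (simp add: power2_eq_square algebra_simps)
  finally show ?thesis using assms(1) by (simp add: zero_le_mult_iff)
qed

text \<open>Each bound is the nonnegativity of a quadratic form in two adjacent coefficients, whose
  discriminant the disk condition controls.\<close>

lemma kraw_energy_bounds: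
  assumes "in_disk \<delta> (p + q) a q" "\<delta> > 0" "p + q > 0"
  shows "\<delta> / 8 * real (p + q) * kraw_norm p q (int a) \<le> kraw_energy p q a"
    and "kraw_energy p q a \<le> 2 * real (p + q) * kraw_norm p q (int a)"
proof -
  define N where "N = real (p + q)"
  define x where "x = krawtchouk p q (int a + 1)"
  define y where "y = krawtchouk p q (int a)"
  define t where "t = real p - real q"
  \<comment> \<open>Half of the distance to the border granted by \<open>in_disk_bounds\<close>.
    Since \<open>8 * l * N = \<delta> * N ^ 2\<close>, subtracting \<open>l\<close> from both
    diagonal entries is paid for by the margin in \<open>in_disk_product\<close>.\<close>
  define l where "l = \<delta> / 8 * N"
  have N: "N \<ge> 1" unfolding N_def using assms(3) by linarith
  note b = in_disk_bounds[OF assms, folded N_def]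
  have t: "\<delta> * N\<^sup>2 + t\<^sup>2 \<le> 4 * (real a * (N - real a))"
    using in_disk_product[OF assms(1)] by (simp add: N_def t_def power2_eq_square algebra_simps)
  have l: "0 < l" "2 * l \<le> real a" "2 * l \<le> N - real a" using b N assms(2) by (auto simp: l_def field_simps)
  have "4 * l * (N + 1) \<le> 4 * l * (N + N)" using l N by (intro mult_left_mono) auto
  also have "\<dots> = \<delta> * N\<^sup>2" by (simp add: l_def power2_eq_square)
  finally have "4 * l * (N + 1) \<le> \<delta> * N\<^sup>2" .
  note lN = this
  have key: "T \<le> P - R + 4 * D + 4 * Q"
    if "R \<le> M" "M + T \<le> P" "0 \<le> D" "0 \<le> Q" for T P R D Q M :: real
    using that by linarith
  have "0 \<le> N - real a" using l by linarith
  then have "t\<^sup>2 \<le> 4 * (real a * (N - real a)) - 4 * l * (N + 1) + 4 * (N - real a) + 4 * l\<^sup>2"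
    by (rule key[OF lN t]) simp
  also have "\<dots> = 4 * ((real a + 1 - l) * (N - real a - l))"
    by (simp add: power2_eq_square algebra_simps)
  finally have "t\<^sup>2 \<le> 4 * ((real a + 1 - l) * (N - real a - l))" .
  then have "0 \<le> (real a + 1 - l) * x\<^sup>2 - t * y * x + (N - real a - l) * y\<^sup>2"
    using l by (intro quadratic_form_nonneg) auto
  then show "\<delta> / 8 * real (p + q) * kraw_norm p q (int a) \<le> kraw_energy p q a"
    unfolding kraw_norm_def kraw_energy_def N_def[symmetric] x_def[symmetric] y_def[symmetric]
      t_def[symmetric] l_def[symmetric] by (simp add: algebra_simps)
  have tN: "\<bar>t\<bar> \<le> N" by (auto simp: t_def N_def)
  have "0 \<le> (2 * N - (real a + 1)) * x\<^sup>2 - (- t) * y * x + (2 * N - (N - real a)) * y\<^sup>2"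
  proof (rule quadratic_form_nonneg)
    show "2 * N - (real a + 1) > 0" using l N by linarith
    have "t\<^sup>2 \<le> 4 * (real a * (N - real a))" using t assms(2) by (smt (verit) mult_nonneg_nonneg zero_le_power2)
    also have "\<dots> \<le> 4 * ((2 * N - (real a + 1)) * (2 * N - (N - real a)))"
    proof -
      have "(N - real a) * real a \<le> (2 * N - (real a + 1)) * (2 * N - (N - real a))"
        using l N by (intro mult_mono) auto
      then show ?thesis by (simp add: mult.commute)
    qed
    finally show "(- t)\<^sup>2 \<le> 4 * ((2 * N - (real a + 1)) * (2 * N - (N - real a)))" by simp
  qed
  then show "kraw_energy p q a \<le> 2 * real (p + q) * kraw_norm p q (int a)"
    unfolding kraw_norm_def kraw_energy_def N_def[symmetric] x_def[symmetric] y_def[symmetric]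
      t_def[symmetric] l_def[symmetric] by (simp add: algebra_simps)
qed

text \<open>Eliminating the outermost coefficient with the recurrence writes consecutive energies in terms of
  the same two quantities \<open>c (a + 1)\<^sup>2\<close> and \<open>c a * c (a + 2)\<close>, which shows their near proportionality.\<close>

lemma kraw_energy_Suc_forms:
  defines "c \<equiv> krawtchouk"
  shows "kraw_energy p q (Suc a) = (real (p + q) - real (Suc a)) * (c p q (int a + 1))\<^sup>2
      - (real (p + q) - real a) * (c p q (int a) * c p q (int a + 2))"
    and "kraw_energy p q a = real (Suc a) * (c p q (int a + 1))\<^sup>2
      - (real a + 2) * (c p q (int a) * c p q (int a + 2))"
proof -
  have "(real a + 2) * c p q (int a + 2)
      = (real p - real q) * c p q (int a + 1) - (real (p + q) - real a) * c p q (int a)"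
    using krawtchouk_recurrence[of "int a + 1" p q] by (simp add: c_def algebra_simps)
  then have r: "(real a + 2) * c p q (int a + 2) * z
      = ((real p - real q) * c p q (int a + 1) - (real (p + q) - real a) * c p q (int a)) * z" for z
    by simp
  show "kraw_energy p q (Suc a) = (real (p + q) - real (Suc a)) * (c p q (int a + 1))\<^sup>2
      - (real (p + q) - real a) * (c p q (int a) * c p q (int a + 2))"
    using r[of "c p q (int a + 2)"]
    by (simp add: kraw_energy_def c_def[symmetric] power2_eq_square algebra_simps)
  show "kraw_energy p q a = real (Suc a) * (c p q (int a + 1))\<^sup>2
      - (real a + 2) * (c p q (int a) * c p q (int a + 2))"
    using r[of "c p q (int a)"]
    by (simp add: kraw_energy_def c_def[symmetric] power2_eq_square algebra_simps)
qed

text \<open>Consecutive binomials have the ratio \<open>(N - 1 - a) / (a + 1)\<close> with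
  \<open>N = p + q\<close>. This is also the ratio of the coefficients of
  \<open>c (a + 1) ^ 2\<close> in the two forms above, so that term cancels from the difference of
  consecutive scaled energies.\<close>

definition kraw_scaled_energy :: "nat \<Rightarrow> nat \<Rightarrow> nat \<Rightarrow> real" where
  "kraw_scaled_energy p q a = kraw_energy p q a / real ((p + q - 1) choose a)"

text \<open>What remains of the difference is a bounded multiple of \<open>x * z\<close>, and the
  energy dominates the squares of the coefficients with a factor of order \<open>N\<close>; hence
  the gain of \<open>1 / N\<close>. The constant is \<open>4 / \<delta>\<close> times
  \<open>96 / \<delta> ^ 2\<close>.\<close>

lemma kraw_scaled_energy_step:
  assumes disk: "in_disk \<delta> (p + q) (Suc a) q" and \<delta>: "\<delta> > 0"
  shows "\<bar>kraw_scaled_energy p q (Suc a) - kraw_scaled_energy p q a\<bar>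
    \<le> 384 / \<delta> ^ 3 / real (p + q) * kraw_scaled_energy p q (Suc a)"
proof (cases "p + q = 0")
  case True
  then show ?thesis using disk \<delta> by (auto simp: in_disk_def)
next
  case False
  define N where "N = real (p + q)"
  define A where "A = real a"
  define b where "b = real ((p + q - 1) choose Suc a)"
  define x where "x = krawtchouk p q (int a)"
  define y where "y = krawtchouk p q (int a + 1)"
  define z where "z = krawtchouk p q (int a + 2)"
  define S where "S = kraw_energy p q (Suc a)"
  have N: "N > 0" unfolding N_def of_nat_0_less_iff using False by simp
  note bd = in_disk_bounds[OF disk \<delta>, folded N_def]
  have A: "\<delta> / 4 * N \<le> A + 1" "\<delta> / 4 * N \<le> N - A - 1" "\<delta> \<le> 1" "A \<ge> 0"
    using bd False by (auto simp: A_def N_def)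
  have dN: "\<delta> / 4 * N > 0" using \<delta> N by simp
  have "Suc a < p + q" using A dN by (simp add: A_def N_def)
  then have b0: "b > 0" by (simp add: b_def)
  have "(A + 1) * b = (N - A - 1) * real ((p + q - 1) choose a)"
  proof -
    have "Suc a * ((p + q - 1) choose Suc a) = (p + q - 1 - a) * ((p + q - 1) choose a)"
      by (simp only: binomial_absorption binomial_absorb_comp)
    then have "real (Suc a) * b = real (p + q - 1 - a) * real ((p + q - 1) choose a)"
      unfolding b_def by (metis of_nat_mult)
    moreover have "real (p + q - 1 - a) = N - A - 1" using \<open>Suc a < p + q\<close> by (auto simp: N_def A_def of_nat_diff)
    ultimately show ?thesis by (simp add: A_def add.commute)
  qed
  then have b': "real ((p + q - 1) choose a) = (A + 1) * b / (N - A - 1)"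
    using A dN by (simp add: field_simps)
  have S1: "S = (N - (A + 1)) * y\<^sup>2 - (N - A) * (x * z)"
    using kraw_energy_Suc_forms(1)[of p q a] by (simp add: S_def N_def A_def x_def y_def z_def)
  have S0: "kraw_energy p q a = (A + 1) * y\<^sup>2 - (A + 2) * (x * z)"
    using kraw_energy_Suc_forms(2)[of p q a] by (simp add: N_def A_def x_def y_def z_def)
  have "kraw_scaled_energy p q (Suc a) - kraw_scaled_energy p q a
      = S / b - ((A + 1) * y\<^sup>2 - (A + 2) * (x * z)) * (N - A - 1) / ((A + 1) * b)"
    unfolding kraw_scaled_energy_def S0 b' by (simp add: S_def b_def)
  also have "\<dots> = ((N - A - 1) / (A + 1) - 1) * (x * z) / b"
  proof -
    define D where "D = A + 1"
    have A: "A = D - 1" "D > 0" using A by (auto simp: D_def)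
    then show ?thesis unfolding S1 A(1) using b0 by (simp add: field_simps)
  qed
  finally have diff: "kraw_scaled_energy p q (Suc a) - kraw_scaled_energy p q a
    = ((N - A - 1) / (A + 1) - 1) * (x * z) / b" .
  have coeff: "\<bar>(N - A - 1) / (A + 1) - 1\<bar> \<le> 4 / \<delta>"
  proof -
    have "(N - A - 1) / (A + 1) - 1 = (N - 2 * (A + 1)) / (A + 1)"
      using A by (simp add: field_simps)
    then have "\<bar>(N - A - 1) / (A + 1) - 1\<bar> = \<bar>N - 2 * (A + 1)\<bar> / (A + 1)"
      using A by (simp add: abs_divide)
    also have "\<dots> \<le> N / (A + 1)"
      using A dN by (intro divide_right_mono) auto
    also have "\<dots> \<le> N / (\<delta> / 4 * N)"
      using A dN N by (intro divide_left_mono) auto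
    finally show ?thesis using N \<delta> by (simp add: field_simps)
  qed
  have norm: "\<delta> / 8 * N * (y\<^sup>2 + z\<^sup>2) \<le> S"
    using kraw_energy_bounds(1)[OF disk \<delta>] False
    by (simp add: N_def S_def kraw_norm_def y_def z_def algebra_simps)
  \<comment> \<open>The energy at \<open>Suc a\<close> controls \<open>y\<close> and
    \<open>z\<close> only; \<open>x\<close> is expressed through them, using that
    \<open>N - A\<close> is at least \<open>\<delta> / 4 * N\<close>.\<close>
  have rec: "(N - A) * x = (real p - real q) * y - (A + 2) * z"
    using krawtchouk_recurrence[of "int a + 1" p q]
    by (simp add: x_def y_def z_def N_def A_def algebra_simps)
  have "\<bar>x\<bar> * (\<delta> / 4 * N) \<le> \<bar>x\<bar> * (N - A)" using A by (intro mult_left_mono) auto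
  also have "\<dots> = \<bar>(real p - real q) * y - (A + 2) * z\<bar>"
    using A dN by (simp add: rec[symmetric] abs_mult)
  also have "\<dots> \<le> \<bar>real p - real q\<bar> * \<bar>y\<bar> + (A + 2) * \<bar>z\<bar>"
    using A abs_triangle_ineq4[of "(real p - real q) * y" "(A + 2) * z"] by (simp add: abs_mult)
  also have "\<dots> \<le> N * \<bar>y\<bar> + (2 * N) * \<bar>z\<bar>"
    using A dN by (intro add_mono mult_right_mono) (auto simp: N_def)
  also have "\<dots> \<le> 2 * N * (\<bar>y\<bar> + \<bar>z\<bar>)" using N by (simp add: algebra_simps)
  also have "\<dots> = (8 / \<delta> * (\<bar>y\<bar> + \<bar>z\<bar>)) * (\<delta> / 4 * N)"
    using \<delta> by simp
  finally have "\<bar>x\<bar> * (\<delta> / 4 * N) \<le> (8 / \<delta> * (\<bar>y\<bar> + \<bar>z\<bar>)) * (\<delta> / 4 * N)" .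
  then have "\<bar>x\<bar> \<le> 8 / \<delta> * (\<bar>y\<bar> + \<bar>z\<bar>)" using dN by (simp only: mult_le_cancel_right_pos)
  then have "\<bar>x\<bar> * \<bar>z\<bar> \<le> 8 / \<delta> * (\<bar>y\<bar> + \<bar>z\<bar>) * \<bar>z\<bar>" by (intro mult_right_mono) auto
  also have "\<dots> = 8 / \<delta> * ((\<bar>y\<bar> + \<bar>z\<bar>) * \<bar>z\<bar>)" by simp
  also have "\<dots> \<le> 8 / \<delta> * (3 / 2 * (y\<^sup>2 + z\<^sup>2))"
  proof (intro mult_left_mono)
    have "0 \<le> (\<bar>y\<bar> - \<bar>z\<bar>)\<^sup>2" by simp
    also have "\<dots> = y\<^sup>2 + z\<^sup>2 - 2 * (\<bar>y\<bar> * \<bar>z\<bar>)" by (simp add: power2_diff)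
    finally have "\<bar>y\<bar> * \<bar>z\<bar> \<le> 1 / 2 * (y\<^sup>2 + z\<^sup>2)" by simp
    moreover have "(\<bar>y\<bar> + \<bar>z\<bar>) * \<bar>z\<bar> = \<bar>y\<bar> * \<bar>z\<bar> + z\<^sup>2" by (simp add: distrib_right power2_eq_square)
    moreover have "T \<le> 3 / 2 * (Y + Z)" if "P \<le> 1 / 2 * (Y + Z)" "T = P + Z" "0 \<le> Y" for T P Y Z :: real
      using that by (simp add: field_simps)
    ultimately show "(\<bar>y\<bar> + \<bar>z\<bar>) * \<bar>z\<bar> \<le> 3 / 2 * (y\<^sup>2 + z\<^sup>2)" using zero_le_power2 by blast
  qed (use \<delta> in auto)
  also have "\<dots> = 96 / (\<delta>\<^sup>2 * N) * (\<delta> / 8 * N * (y\<^sup>2 + z\<^sup>2))"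
    using \<delta> N by (simp add: field_simps power2_eq_square)
  also have "\<dots> \<le> 96 / (\<delta>\<^sup>2 * N) * S" using norm \<delta> N by (intro mult_left_mono) auto
  finally have xz: "\<bar>x * z\<bar> \<le> 96 / (\<delta>\<^sup>2 * N) * S" by (simp add: abs_mult)
  have "\<bar>kraw_scaled_energy p q (Suc a) - kraw_scaled_energy p q a\<bar>
      = \<bar>(N - A - 1) / (A + 1) - 1\<bar> * \<bar>x * z\<bar> / b"
    unfolding diff using b0 by (simp add: abs_mult)
  also have "\<dots> \<le> (4 / \<delta>) * (96 / (\<delta>\<^sup>2 * N) * S) / b"
    using coeff xz b0 \<delta> by (intro divide_right_mono mult_mono) auto
  also have "\<dots> = 384 / \<delta> ^ 3 / N * (S / b)" using \<delta> N by (simp add: field_simps power2_eq_square power3_eq_cube)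
  finally show ?thesis unfolding N_def S_def b_def kraw_scaled_energy_def .
qed

text \<open>There are at most \<open>p + q\<close> steps, each costing a factor
  \<open>1 + 2 * K\<close> with \<open>K\<close> of order \<open>1 / (p + q)\<close>, so the total
  stays below a constant independent of \<open>p + q\<close>.\<close>

lemma kraw_scaled_energy_chain:
  assumes "\<And>i. a \<le> i \<Longrightarrow> i \<le> a' \<Longrightarrow> in_disk \<delta> (p + q) i q"
    and \<delta>: "\<delta> > 0" and N: "real (p + q) \<ge> 768 / \<delta> ^ 3" and "a \<le> a'" "a' \<le> p + q"
  shows "kraw_scaled_energy p q a \<le> exp (768 / \<delta> ^ 3) * kraw_scaled_energy p q a'"
    and "kraw_scaled_energy p q a' \<le> exp (768 / \<delta> ^ 3) * kraw_scaled_energy p q a"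
proof -
  define K where "K = 384 / \<delta> ^ 3 / real (p + q)"
  define W where "W = kraw_scaled_energy p q"
  have N0: "p + q > 0" using N \<delta> by (metis divide_pos_pos less_le_trans of_nat_0_less_iff zero_less_numeral zero_less_power)
  have K: "0 < K" "K \<le> 1 / 2" using N \<delta> N0 by (auto simp: K_def field_simps)
  have W0: "W i \<ge> 0" if "in_disk \<delta> (p + q) i q" for i
  proof -
    have "0 \<le> \<delta> / 8 * real (p + q) * kraw_norm p q (int i)" using \<delta> by (simp add: kraw_norm_def)
    also note kraw_energy_bounds(1)[OF that \<delta> N0]
    finally show ?thesis by (simp add: W_def kraw_scaled_energy_def)
  qed
  have *: "W a \<le> (1 + 2 * K) ^ d * W (a + d) \<and> W (a + d) \<le> (1 + 2 * K) ^ d * W a"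
    if "a + d \<le> a'" for d
    using that
  proof (induction d)
    case (Suc d)
    define u where "u = W (a + d)"
    define v where "v = W (a + Suc d)"
    have disk: "in_disk \<delta> (p + q) (a + Suc d) q" using assms(1) Suc.prems by simp
    have "\<bar>v - u\<bar> \<le> K * v"
      using kraw_scaled_energy_step[of \<delta> p q "a + d"] disk \<delta> by (simp add: v_def u_def W_def K_def)
    moreover have "v \<ge> 0" using W0[OF disk] by (simp add: v_def)
    ultimately have uv: "u \<le> (1 + K) * v" "(1 - K) * v \<le> u" by (auto simp: algebra_simps abs_le_iff)
    have "(1 + K) * v \<le> (1 + 2 * K) * v" using K \<open>v \<ge> 0\<close> by (intro mult_right_mono) auto
    then have 1: "u \<le> (1 + 2 * K) * v" using uv by linarith
    \<comment> \<open>\<open>K \<le> 1 / 2\<close> makes \<open>1 + 2 * K\<close> an upper bound of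
      \<open>1 / (1 - K)\<close>; the lower bound on \<open>p + q\<close> provides this.\<close>
    have "1 \<le> (1 + 2 * K) * (1 - K)" using K by (simp add: algebra_simps power2_eq_square)
    then have "v \<le> (1 + 2 * K) * (1 - K) * v" using \<open>v \<ge> 0\<close> mult_right_mono by fastforce
    also have "\<dots> \<le> (1 + 2 * K) * u" using mult_left_mono[OF uv(2), of "1 + 2 * K"] K by (simp add: mult_ac)
    finally have 2: "v \<le> (1 + 2 * K) * u" .
    have IH: "W a \<le> (1 + 2 * K) ^ d * u" "u \<le> (1 + 2 * K) ^ d * W a" using Suc by (auto simp: u_def)
    have "(1 + 2 * K) ^ d * u \<le> (1 + 2 * K) ^ d * ((1 + 2 * K) * v)" using 1 K by (intro mult_left_mono) auto
    moreover have "(1 + 2 * K) * u \<le> (1 + 2 * K) * ((1 + 2 * K) ^ d * W a)" using IH K by (intro mult_left_mono) auto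
    ultimately show ?case using IH 2 unfolding v_def[symmetric] by (simp add: mult_ac)
  qed simp
  define d where "d = a' - a"
  have d: "a + d = a'" "d \<le> p + q" using assms by (auto simp: d_def)
  have E: "(1 + 2 * K) ^ d \<le> exp (768 / \<delta> ^ 3)"
  proof -
    have "(1 + 2 * K) ^ d \<le> exp (2 * K) ^ d" using K by (intro power_mono exp_ge_add_one_self) auto
    also have "\<dots> = exp (real d * (2 * K))" by (simp add: exp_of_nat_mult)
    also have "\<dots> \<le> exp (real (p + q) * (2 * K))" using d K by simp
    also have "real (p + q) * (2 * K) = 768 / \<delta> ^ 3"
      unfolding K_def using N0 by (simp del: of_nat_add)
    finally show ?thesis .
  qed
  have "W a \<ge> 0" "W a' \<ge> 0" using W0 assms(1,4) by simp_all
  then show "kraw_scaled_energy p q a \<le> exp (768 / \<delta> ^ 3) * kraw_scaled_energy p q a'"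
    and "kraw_scaled_energy p q a' \<le> exp (768 / \<delta> ^ 3) * kraw_scaled_energy p q a"
    using *[of d] d(1) mult_right_mono[OF E, of "W a'"] mult_right_mono[OF E, of "W a"]
    by (auto simp: W_def)
qed

section \<open>Central values\<close>

text \<open>The factorials are those of \<open>(p + q choose q) / (p + q choose a)\<close>. They invert when \<open>a\<close> and \<open>q\<close> are
  exchanged, so they drop out of the product of a black and a white gauge function.\<close>

definition kraw_mass :: "nat \<Rightarrow> nat \<Rightarrow> nat \<Rightarrow> real" where
  "kraw_mass p q a =
     kraw_norm p q (int a) * (fact a * fact (p + q - a)) / (fact p * fact q * 2 ^ (p + q))"

section \<open>Central binomial ratios\<close>

definition central_ratio :: "nat \<Rightarrow> real" where
  "central_ratio l = fact (2 * l) / ((fact l)\<^sup>2 * 4 ^ l)"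

lemma central_ratio_Suc:
  "central_ratio (Suc l) = central_ratio l * ((2 * real l + 1) / (2 * real l + 2))"
proof -
  define x where "x = real l + 1"
  have x: "x > 0" by (simp add: x_def)
  have l: "2 * real l + 1 = 2 * x - 1" "2 * real l + 2 = 2 * x" by (simp_all add: x_def)
  have f: "fact (2 * Suc l) = 2 * x * (2 * x - 1) * fact (2 * l)" "fact (Suc l) = x * fact l"
    by (simp_all add: x_def algebra_simps)
  show ?thesis
    unfolding central_ratio_def f l using x by (simp add: power2_eq_square field_simps)
qed

lemma central_ratio_pos: "central_ratio l > 0"
  by (simp add: central_ratio_def)

text \<open>\<open>central_ratio l\<close> is \<open>2 * l choose l\<close> over
  \<open>4 ^ l\<close>, which decays like \<open>1 / sqrt l\<close>. Its square times
  \<open>2 * l + 1\<close> decreases, starting from 1.\<close>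

lemma central_ratio_upper: "(central_ratio l)\<^sup>2 * (2 * real l + 1) \<le> 1"
proof (induction l)
  case 0
  then show ?case by (simp add: central_ratio_def)
next
  case (Suc l)
  have "(central_ratio (Suc l))\<^sup>2 * (2 * real (Suc l) + 1)
      = ((central_ratio l)\<^sup>2 * (2 * real l + 1)) * ((2 * real l + 1) * (2 * real l + 3) / (2 * real l + 2)\<^sup>2)"
    by (simp add: central_ratio_Suc power2_eq_square field_simps)
  also have "\<dots> \<le> 1 * 1"
  proof (intro mult_mono Suc.IH)
    show "(2 * real l + 1) * (2 * real l + 3) / (2 * real l + 2)\<^sup>2 \<le> 1"
      by (rule divide_le_eq_1_pos[THEN iffD2], rule zero_less_power)
         (simp_all add: power2_eq_square algebra_simps)
  qed auto
  finally show ?case by simp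
qed

text \<open>The square of the ratio times \<open>4 * l\<close> increases and equals 1 at
  \<open>l = 1\<close>.\<close>

lemma central_ratio_lower: "1 \<le> (central_ratio (Suc l))\<^sup>2 * (4 * real (Suc l))"
proof (induction l)
  case 0
  then show ?case by (simp add: central_ratio_def power2_eq_square)
next
  case (Suc l)
  have "1 * 1 \<le> ((central_ratio (Suc l))\<^sup>2 * (4 * real (Suc l)))
     * ((2 * real l + 3)\<^sup>2 / ((2 * real l + 2) * (2 * real l + 4)))"
  proof (intro mult_mono Suc.IH)
    show "1 \<le> (2 * real l + 3)\<^sup>2 / ((2 * real l + 2) * (2 * real l + 4))"
      by (rule le_divide_eq_1_pos[THEN iffD2], rule mult_pos_pos)
         (simp_all add: power2_eq_square algebra_simps)
  qed auto
  also have "\<dots> = (central_ratio (Suc (Suc l)))\<^sup>2 * (4 * real (Suc (Suc l)))"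
    unfolding central_ratio_Suc[of "Suc l"] power_mult_distrib power_divide
    by (simp add: power2_eq_square divide_simps) (simp add: algebra_simps)
  finally show ?case by simp
qed

text \<open>For even exponents reflection makes the coefficients symmetric about the middle, so the
  three-term recurrence there relates only two values.\<close>

lemma krawtchouk_near_center:
  fixes P Q :: nat
  defines "c \<equiv> krawtchouk (2 * P) (2 * Q)" and "m \<equiv> int (P + Q)"
  shows "(real (P + Q) + 1) * c (m + 1) = (real P - real Q) * c m"
    and "c (m - 1) = c (m + 1)"
proof -
  show eq: "c (m - 1) = c (m + 1)"
    using krawtchouk_reflect[of "2 * P" "2 * Q" "m + 1"] by (simp add: c_def m_def algebra_simps)
  show "(real (P + Q) + 1) * c (m + 1) = (real P - real Q) * c m"
    using krawtchouk_recurrence[of m "2 * P" "2 * Q"]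
    by (simp add: c_def[symmetric] eq) (simp add: m_def algebra_simps)
qed

text \<open>A further factor \<open>(1 + z) ^ 2\<close> or \<open>(1 - z) ^ 2\<close> moves the
  middle by one and produces \<open>c (m + 1) + c (m - 1)\<close> plus or minus
  \<open>2 * c m\<close>, a multiple of \<open>c m\<close> by \<open>krawtchouk_near_center\<close>.
  Up to sign the values are the super Catalan numbers.\<close>

lemma krawtchouk_center:
  "krawtchouk (2 * P) (2 * Q) (int (P + Q))
     = (-1) ^ Q * fact (2 * P) * fact (2 * Q) / (fact P * fact Q * fact (P + Q))"
proof (induction Q arbitrary: P)
  case 0
  show ?case
  proof (induction P)
    case (Suc P)
    define c where "c = krawtchouk (2 * P) 0"
    have near: "(real P + 1) * c (int P + 1) = real P * c (int P)" "c (int P - 1) = c (int P + 1)"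
      using krawtchouk_near_center[of P 0] by (simp_all add: c_def)
    have "krawtchouk (2 * Suc P) (2 * 0) (int (Suc P + 0)) = c (int P + 1) + 2 * c (int P) + c (int P - 1)"
      by (simp add: c_def algebra_simps)
    then have "(real P + 1) * krawtchouk (2 * Suc P) (2 * 0) (int (Suc P + 0)) = (4 * real P + 2) * c (int P)"
      using near by (simp add: algebra_simps)
    moreover define x where "x = real P + 1"
    moreover have "x > 0" by (simp add: x_def)
    ultimately have "krawtchouk (2 * Suc P) (2 * 0) (int (Suc P + 0)) = (4 * x - 2) / x * c (int P)"
      by (simp only: nonzero_eq_divide_eq less_irrefl times_divide_eq_left) (simp add: algebra_simps)
    also have "c (int P) = fact (2 * P) / (fact P * fact P)" using Suc by (simp add: c_def)
    also have "(4 * x - 2) / x * \<dots> = 2 * x * (2 * x - 1) * fact (2 * P) / ((x * fact P) * (x * fact P))"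
      using \<open>x > 0\<close> by (simp add: field_simps)
    also have "2 * x * (2 * x - 1) * fact (2 * P) = fact (2 * Suc P)"
      by (simp add: x_def algebra_simps)
    also have "x * fact P = fact (Suc P)" by (simp add: x_def)
    finally show ?case by simp
  qed simp
next
  case (Suc Q)
  define c where "c = krawtchouk (2 * P) (2 * Q)"
  define m where "m = int (P + Q)"
  have near: "(real (P + Q) + 1) * c (m + 1) = (real P - real Q) * c m" "c (m - 1) = c (m + 1)"
    using krawtchouk_near_center[of P Q] by (simp_all add: c_def m_def)
  have "krawtchouk (2 * P) (2 * Suc Q) (int (P + Suc Q)) = c (m + 1) - 2 * c m + c (m - 1)"
    by (simp add: c_def m_def krawtchouk_Suc_right algebra_simps)
  then have k0: "krawtchouk (2 * P) (2 * Suc Q) (int (P + Suc Q)) = 2 * c (m + 1) - 2 * c m"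
    using near(2) by simp
  have k: "(real (P + Q) + 1) * krawtchouk (2 * P) (2 * Suc Q) (int (P + Suc Q)) = - (4 * real Q + 2) * c m"
    unfolding k0 using near(1) by (simp add: algebra_simps)
  define x where "x = real Q + 1"
  define y where "y = real (P + Q) + 1"
  have x: "x > 0" "y > 0" by (simp_all add: x_def y_def)
  have "krawtchouk (2 * P) (2 * Suc Q) (int (P + Suc Q)) = - (4 * x - 2) * c m / y"
    using k x by (simp add: x_def y_def field_simps)
  also have "c m = (-1) ^ Q * fact (2 * P) * fact (2 * Q) / (fact P * fact Q * fact (P + Q))"
    using Suc by (simp add: c_def m_def)
  also have "- (4 * x - 2) * \<dots> / y = (-1) ^ Suc Q * fact (2 * P) * (2 * x * (2 * x - 1) * fact (2 * Q))
      / (fact P * (x * fact Q) * (y * fact (P + Q)))"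
    using x by (simp add: field_simps)
  also have "2 * x * (2 * x - 1) * fact (2 * Q) = fact (2 * Suc Q)"
    by (simp add: x_def algebra_simps)
  also have "x * fact Q = fact (Suc Q)" by (simp add: x_def)
  also have "y * fact (P + Q) = fact (P + Suc Q)" by (simp add: y_def)
  finally show ?case .
qed

text \<open>An odd exponent means one more factor \<open>1 + z\<close> or \<open>1 - z\<close>, so
  every parity reduces to even exponents and the single value \<open>e\<close>. All four cases share
  \<open>B\<close>, to which the factorials collapse.\<close>

lemma kraw_mass_center:
  fixes P Q :: nat
  defines "B \<equiv> central_ratio P * central_ratio Q" and "m \<equiv> P + Q"
  shows "kraw_mass (2 * P) (2 * Q) m = B * (1 + ((real P - real Q) / (real m + 1))\<^sup>2)"
    and "kraw_mass (2 * P + 1) (2 * Q) m = B * ((2 * real P + 1) / (real m + 1))"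
    and "kraw_mass (2 * P) (2 * Q + 1) m = B * ((2 * real Q + 1) / (real m + 1))"
    and "kraw_mass (2 * P + 1) (2 * Q + 1) (m + 1)
      = B * ((2 * real P + 1) * (2 * real Q + 1) / (real m + 2)\<^sup>2)"
proof -
  define c where "c = krawtchouk (2 * P) (2 * Q)"
  define e where "e = c (int m)"
  have near: "(real m + 1) * c (int m + 1) = (real P - real Q) * e" "c (int m - 1) = c (int m + 1)"
    using krawtchouk_near_center[of P Q] by (simp_all add: c_def m_def e_def)
  have m0: "real m + 1 > 0" "real m + 2 > 0" by linarith+
  have m2: "2 * P + 2 * Q = 2 * m" by (simp add: m_def)
  have c1: "c (int m + 1) = (real P - real Q) / (real m + 1) * e" "c (int m - 1) = (real P - real Q) / (real m + 1) * e"
    using near m0 by (simp_all add: field_simps)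
  have "e = (-1) ^ Q * fact (2 * P) * fact (2 * Q) / (fact P * fact Q * fact m)"
    unfolding e_def c_def m_def by (rule krawtchouk_center)
  moreover have "((-1::real) ^ Q)\<^sup>2 = 1" by (cases "even Q") auto
  ultimately have e2: "e\<^sup>2 * (fact m * fact m) = B * (fact (2 * P) * fact (2 * Q) * 4 ^ m)"
    by (simp add: power_mult_distrib power_divide B_def central_ratio_def)
       (simp add: m_def power2_eq_square power_add mult_ac)
  have D: "fact (2 * P) * fact (2 * Q) * 4 ^ m \<noteq> (0::real)" by simp
  have base: "e\<^sup>2 * (fact m * fact m) / (fact (2 * P) * fact (2 * Q) * 4 ^ m) = B"
    unfolding e2 using D by simp
  have four: "(2::real) ^ (2 * m) = 4 ^ m" by (simp add: power_mult)
  have "kraw_norm (2 * P) (2 * Q) (int m) = e\<^sup>2 * (1 + ((real P - real Q) / (real m + 1))\<^sup>2)"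
    unfolding kraw_norm_def c_def[symmetric] c1 e_def[symmetric] power_mult_distrib
    by (simp only: distrib_left mult_1_right mult.commute)
  then have "kraw_mass (2 * P) (2 * Q) m = (e\<^sup>2 * (fact m * fact m) / (fact (2 * P) * fact (2 * Q) * 4 ^ m))
    * (1 + ((real P - real Q) / (real m + 1))\<^sup>2)"
    unfolding kraw_mass_def m2 four by (simp add: mult_ac)
  then show "kraw_mass (2 * P) (2 * Q) m = B * (1 + ((real P - real Q) / (real m + 1))\<^sup>2)"
    by (simp only: base)
  have mPQ: "real m = real P + real Q" by (simp add: m_def)
  have k1: "krawtchouk (2 * P + 1) (2 * Q) a = c a + c (a - 1)" for a by (simp add: c_def)
  have k2: "krawtchouk (2 * P) (2 * Q + 1) a = c a - c (a - 1)" for a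
    by (simp add: c_def krawtchouk_Suc_right)
  \<comment> \<open>For odd \<open>p + q\<close> the two middle coefficients are equal or opposite;
    these sums are their values up to sign.\<close>
  have s1: "e + (real P - real Q) / (real m + 1) * e = e * ((2 * real P + 1) / (real m + 1))"
    and s2: "e - (real P - real Q) / (real m + 1) * e = e * ((2 * real Q + 1) / (real m + 1))"
    using m0 unfolding mPQ by (simp_all add: field_simps)
  define M where "M = real m + 1"
  define s where "s = 2 * real P + 1"
  define t where "t = 2 * real Q + 1"
  define L where "L = real m + 2"
  have pos: "M > 0" "s > 0" "t > 0" "L > 0" by (simp_all add: M_def s_def t_def L_def)
  have facts: "fact (Suc m) = M * fact m" "fact (2 * P + 1) = s * fact (2 * P)"
    "fact (2 * Q + 1) = t * fact (2 * Q)" "(2::real) ^ Suc (2 * m) = 2 * 4 ^ m"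
    "(2::real) ^ Suc (Suc (2 * m)) = 4 * 4 ^ m"
    by (simp_all add: M_def s_def t_def four)
  have arith: "2 * (e * (s / M))\<^sup>2 * (g * (M * g)) / ((s * f1) * f2 * (2 * F))
      = (e\<^sup>2 * (g * g) / (f1 * f2 * F)) * (s / M)"
    "2 * (e * (t / M))\<^sup>2 * (g * (M * g)) / (f1 * (t * f2) * (2 * F))
      = (e\<^sup>2 * (g * g) / (f1 * f2 * F)) * (t / M)"
    "(2 * s * t / (M * L) * e)\<^sup>2 * ((M * g) * (M * g)) / ((s * f1) * (t * f2) * (4 * F))
      = (e\<^sup>2 * (g * g) / (f1 * f2 * F)) * (s * t / L\<^sup>2)"
    if "f1 > 0" "f2 > 0" "F > 0" for f1 f2 F g :: real
    using pos that by (simp_all add: field_simps power2_eq_square)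
  have "kraw_norm (2 * P + 1) (2 * Q) (int m) = 2 * (e * ((2 * real P + 1) / (real m + 1)))\<^sup>2"
  proof -
    have "krawtchouk (2 * P + 1) (2 * Q) (int m) = e * ((2 * real P + 1) / (real m + 1))"
      "krawtchouk (2 * P + 1) (2 * Q) (int m + 1) = e * ((2 * real P + 1) / (real m + 1))"
      using s1 by (simp_all only: k1 add_diff_cancel_right' c1 e_def[symmetric])
    then show ?thesis by (simp add: kraw_norm_def)
  qed
  moreover have "2 * P + 1 + 2 * Q - m = Suc m" "2 * P + 1 + 2 * Q = Suc (2 * m)" by (simp_all add: m_def)
  ultimately have "kraw_mass (2 * P + 1) (2 * Q) m = (e\<^sup>2 * (fact m * fact m) / (fact (2 * P) * fact (2 * Q) * 4 ^ m))
    * ((2 * real P + 1) / (real m + 1))"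
    unfolding kraw_mass_def M_def[symmetric] s_def[symmetric] t_def[symmetric]
    by (simp only: facts arith fact_gt_zero zero_less_power zero_less_numeral)
  then show "kraw_mass (2 * P + 1) (2 * Q) m = B * ((2 * real P + 1) / (real m + 1))"
    by (simp only: base)
  have "kraw_norm (2 * P) (2 * Q + 1) (int m) = 2 * (e * ((2 * real Q + 1) / (real m + 1)))\<^sup>2"
  proof -
    have "krawtchouk (2 * P) (2 * Q + 1) (int m) = e * ((2 * real Q + 1) / (real m + 1))"
      "krawtchouk (2 * P) (2 * Q + 1) (int m + 1) = - (e * ((2 * real Q + 1) / (real m + 1)))"
      using s2 by (simp_all only: k2 add_diff_cancel_right' c1 e_def[symmetric] )
    then show ?thesis by (simp add: kraw_norm_def)
  qed
  moreover have "2 * P + (2 * Q + 1) - m = Suc m" "2 * P + (2 * Q + 1) = Suc (2 * m)" by (simp_all add: m_def)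
  ultimately have "kraw_mass (2 * P) (2 * Q + 1) m = (e\<^sup>2 * (fact m * fact m) / (fact (2 * P) * fact (2 * Q) * 4 ^ m))
    * ((2 * real Q + 1) / (real m + 1))"
    unfolding kraw_mass_def M_def[symmetric] s_def[symmetric] t_def[symmetric]
    by (simp only: facts arith fact_gt_zero zero_less_power zero_less_numeral)
  then show "kraw_mass (2 * P) (2 * Q + 1) m = B * ((2 * real Q + 1) / (real m + 1))"
    by (simp only: base)
  \<comment> \<open>The two extra factors multiply to \<open>1 - z ^ 2\<close>. The coefficient at
    \<open>m + 1\<close> vanishes by symmetry, so the norm is the square of the one at
    \<open>m + 2\<close>, found from the recurrence.\<close>
  have "kraw_norm (2 * P + 1) (2 * Q + 1) (int (m + 1))
    = (2 * (2 * real P + 1) * (2 * real Q + 1) / ((real m + 1) * (real m + 2)) * e)\<^sup>2"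
  proof -
    have k: "krawtchouk (2 * P + 1) (2 * Q + 1) a = c a - c (a - 2)" for a
      by (simp add: c_def krawtchouk_Suc_right)
    have "(real m + 2) * c (int m + 2) = (2 * real P - 2 * real Q) * c (int m + 1) - real m * e"
      using krawtchouk_recurrence[of "int m + 1" "2 * P" "2 * Q"]
      by (simp add: c_def[symmetric] e_def[symmetric]) (simp add: mPQ algebra_simps)
    then have "(real m + 1) * (real m + 2) * c (int m + 2)
      = (2 * (real P - real Q)\<^sup>2 - real m * (real m + 1)) * e"
      using m0 unfolding c1 by (simp add: field_simps power2_eq_square)
    then have "(real m + 1) * (real m + 2) * (c (int m + 2) - e) = - (2 * (2 * real P + 1) * (2 * real Q + 1) * e)"
      unfolding mPQ by (simp add: power2_eq_square algebra_simps)
    then have "M * L * (c (int m + 2) - e) = - (2 * s * t * e)"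
      by (simp only: M_def L_def s_def t_def)
    then have "c (int m + 2) - e = - (2 * s * t / (M * L) * e)"
      using pos by (simp add: field_simps)
    then have "c (int m + 2) - e = - (2 * (2 * real P + 1) * (2 * real Q + 1) / ((real m + 1) * (real m + 2)) * e)"
      by (simp only: M_def L_def s_def t_def)
    moreover have "c (int m + 1) - c (int m - 1) = 0" using near by simp
    moreover have "kraw_norm (2 * P + 1) (2 * Q + 1) (int (m + 1))
        = (c (int m + 1) - c (int m - 1))\<^sup>2 + (c (int m + 2) - e)\<^sup>2"
      unfolding kraw_norm_def k by (simp add: e_def add.commute)
    ultimately show ?thesis by (simp only: zero_power2 power2_minus add_0_left)
  qed
  moreover have "2 * P + 1 + (2 * Q + 1) - (m + 1) = Suc m" "2 * P + 1 + (2 * Q + 1) - Suc m = Suc m" "2 * P + 1 + (2 * Q + 1) = Suc (Suc (2 * m))" by (simp_all add: m_def)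
  ultimately have "kraw_mass (2 * P + 1) (2 * Q + 1) (m + 1) = (e\<^sup>2 * (fact m * fact m) / (fact (2 * P) * fact (2 * Q) * 4 ^ m))
    * ((2 * real P + 1) * (2 * real Q + 1) / (real m + 2)\<^sup>2)"
    unfolding kraw_mass_def M_def[symmetric] s_def[symmetric] t_def[symmetric] L_def[symmetric]
    by (simp only: facts arith fact_gt_zero zero_less_power zero_less_numeral Suc_eq_plus1[symmetric, of m])
  then show "kraw_mass (2 * P + 1) (2 * Q + 1) (m + 1)
      = B * ((2 * real P + 1) * (2 * real Q + 1) / (real m + 2)\<^sup>2)"
    by (simp only: base)
qed

text \<open>The disk condition keeps \<open>p\<close> and \<open>q\<close> above
  \<open>\<delta> / 4 * (p + q)\<close>, so both central ratios are of order
  \<open>1 / sqrt (p + q)\<close> and their product \<open>B\<close> is of order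
  \<open>1 / (p + q)\<close>.\<close>

lemma kraw_mass_center_bounds:
  assumes disk: "in_disk \<delta> (p + q) a q" and \<delta>: "\<delta> > 0" and large: "real (p + q) \<ge> 16 / \<delta>"
  shows "\<delta> / 4 / real (p + q) \<le> kraw_mass p q ((p + q) div 2)"
    and "kraw_mass p q ((p + q) div 2) \<le> 4 / \<delta> / real (p + q)"
proof -
  define N where "N = real (p + q)"
  define P where "P = p div 2"
  define Q where "Q = q div 2"
  define B where "B = central_ratio P * central_ratio Q"
  have "N > 0" unfolding N_def using large \<delta> by (meson divide_pos_pos less_le_trans zero_less_numeral)
  then have "p + q > 0" by (simp add: N_def del: of_nat_add)
  have Npq: "N = real p + real q" by (simp add: N_def)
  note qb = in_disk_bounds[OF disk[THEN in_disk_commute[THEN iffD1]] \<delta> \<open>p + q > 0\<close>, folded N_def]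
  then have pq: "\<delta> / 4 * N \<le> real p" "\<delta> / 4 * N \<le> real q" "\<delta> \<le> 1" using Npq by auto
  have "4 \<le> \<delta> / 4 * N" using large \<delta> by (simp add: N_def field_simps)
  then have "real p \<ge> 4" "real q \<ge> 4" using pq by auto
  then have "p \<ge> 4" "q \<ge> 4" by simp_all
  then have PQ1: "P \<ge> 1" "Q \<ge> 1" by (auto simp: P_def Q_def)
  have prod: "\<delta> * N\<^sup>2 \<le> 4 * (real p * real q)"
  proof -
    have "\<delta> * N\<^sup>2 \<le> 4 * (real q * (N - real q))"
      using in_disk_product[OF disk[THEN in_disk_commute[THEN iffD1]], folded N_def]
        zero_le_power2[of "2 * real a - N"] by linarith
    then show ?thesis using Npq by (simp add: mult.commute)
  qed
  have B0: "B > 0" by (simp add: B_def central_ratio_pos)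
  have B_lower: "1 / N \<le> B"
  proof -
    have l: "1 \<le> (central_ratio P)\<^sup>2 * (4 * real P)" "1 \<le> (central_ratio Q)\<^sup>2 * (4 * real Q)"
      using central_ratio_lower[of "P - 1"] central_ratio_lower[of "Q - 1"] PQ1 by auto
    have "1 * 1 \<le> ((central_ratio P)\<^sup>2 * (4 * real P)) * ((central_ratio Q)\<^sup>2 * (4 * real Q))"
      by (rule mult_mono) (use l in auto)
    also have "\<dots> = B\<^sup>2 * (16 * real P * real Q)" by (simp add: B_def power2_eq_square)
    also have "\<dots> \<le> B\<^sup>2 * N\<^sup>2"
    proof (rule mult_left_mono)
      have "2 * real P \<le> real p" "2 * real Q \<le> real q"
        unfolding P_def Q_def by linarith+
      then have "(2 * real P) * (2 * real Q) \<le> real p * real q" by (intro mult_mono) auto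
      moreover have "0 \<le> (real p - real q)\<^sup>2" by simp
      ultimately show "16 * real P * real Q \<le> N\<^sup>2"
        unfolding Npq by (simp add: power2_eq_square algebra_simps)
    qed simp
    finally have "1 \<le> (B * N)\<^sup>2" by (simp add: power_mult_distrib)
    then have "1 \<le> B * N" using power2_le_imp_le[of 1 "B * N"] B0 \<open>N > 0\<close> by simp
    then show ?thesis using \<open>N > 0\<close> by (simp add: field_simps)
  qed
  have B_upper: "B \<le> 2 / \<delta> / N"
  proof -
    have "((central_ratio P)\<^sup>2 * (2 * real P + 1)) * ((central_ratio Q)\<^sup>2 * (2 * real Q + 1)) \<le> 1 * 1"
      by (rule mult_mono) (use central_ratio_upper[of P] central_ratio_upper[of Q] in auto)
    then have "B\<^sup>2 * ((2 * real P + 1) * (2 * real Q + 1)) \<le> 1"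
      by (simp add: B_def power2_eq_square algebra_simps)
    moreover have "(\<delta> / 2 * N)\<^sup>2 \<le> (2 * real P + 1) * (2 * real Q + 1)"
    proof -
      have "\<delta> * (\<delta> * N\<^sup>2) \<le> 1 * (\<delta> * N\<^sup>2)" using pq \<delta> by (intro mult_right_mono) auto
      then have "(\<delta> / 2 * N)\<^sup>2 \<le> real p * real q" using prod by (simp add: power2_eq_square algebra_simps)
      also have "\<dots> \<le> (2 * real P + 1) * (2 * real Q + 1)"
      proof (rule mult_mono)
        show "real p \<le> 2 * real P + 1" "real q \<le> 2 * real Q + 1"
          unfolding P_def Q_def by linarith+
      qed auto
      finally show ?thesis .
    qed
    then have "B\<^sup>2 * (\<delta> / 2 * N)\<^sup>2 \<le> B\<^sup>2 * ((2 * real P + 1) * (2 * real Q + 1))"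
      by (rule mult_left_mono) simp
    ultimately have "B\<^sup>2 * (\<delta> / 2 * N)\<^sup>2 \<le> 1" by (rule order_trans[rotated])
    then have "(B * (\<delta> / 2 * N))\<^sup>2 \<le> 1" by (simp only: power_mult_distrib)
    then have "B * (\<delta> / 2 * N) \<le> 1" using power2_le_imp_le[of "B * (\<delta> / 2 * N)" 1] by simp
    then show ?thesis using \<open>N > 0\<close> \<delta> by (simp add: field_simps)
  qed
  \<comment> \<open>The factor next to \<open>B\<close> in \<open>kraw_mass_center\<close>, by
    parity. Its lower bound involves \<open>\<delta>\<close> because \<open>p\<close> or
    \<open>q\<close> may be a small fraction of \<open>N\<close>.\<close>
  obtain r where r: "kraw_mass p q ((p + q) div 2) = B * r" "\<delta> / 4 \<le> r" "r \<le> 2"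
  proof -
    define m where "m = P + Q"
    have m: "real m = real P + real Q" by (simp add: m_def)
    note mass = kraw_mass_center[of P Q, folded B_def m_def]
    consider "p = 2 * P" "q = 2 * Q" | "p = 2 * P + 1" "q = 2 * Q" | "p = 2 * P" "q = 2 * Q + 1"
      | "p = 2 * P + 1" "q = 2 * Q + 1" unfolding P_def Q_def by linarith
    then show thesis
    proof cases
      case 1
      then have "(p + q) div 2 = m" by (simp add: m_def)
      define z where "z = ((real P - real Q) / (real m + 1))\<^sup>2"
      have "kraw_mass p q ((p + q) div 2) = B * (1 + z)"
        using mass(1) 1 \<open>(p + q) div 2 = m\<close> by (simp add: z_def)
      moreover have "\<bar>(real P - real Q) / (real m + 1)\<bar> \<le> 1" by (simp add: abs_divide m)
      then have "z \<le> 1" by (simp add: abs_square_le_1 z_def)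
      moreover have "0 \<le> z" by (simp add: z_def)
      then have "\<delta> / 4 \<le> 1 + z" using pq(3) by simp
      ultimately show thesis by (intro that[of "1 + z"]) auto
    next
      case 2
      then have "(p + q) div 2 = m" by (simp add: m_def)
      moreover have "\<delta> / 4 * (real m + 1) \<le> \<delta> / 4 * N"
        using \<delta> 2 Npq by (intro mult_left_mono) (auto simp: m)
      then have "\<delta> / 4 * (real m + 1) \<le> 2 * real P + 1" using pq(1) 2 by simp
      ultimately show thesis using mass(2) 2
        by (intro that[of "(2 * real P + 1) / (real m + 1)"]) (auto simp: m field_simps)
    next
      case 3
      then have "(p + q) div 2 = m" by (simp add: m_def)
      moreover have "\<delta> / 4 * (real m + 1) \<le> \<delta> / 4 * N"
        using \<delta> 3 Npq by (intro mult_left_mono) (auto simp: m)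
      then have "\<delta> / 4 * (real m + 1) \<le> 2 * real Q + 1" using pq(2) 3 by simp
      ultimately show thesis using mass(3) 3
        by (intro that[of "(2 * real Q + 1) / (real m + 1)"]) (auto simp: m field_simps)
    next
      case 4
      then have c: "(p + q) div 2 = m + 1" by (simp add: m_def)
      have N: "N = 2 * real m + 2" using 4 Npq by (simp add: m)
      have "real p * real q \<le> (real m + 2)\<^sup>2"
        using 4 zero_le_power2[of "real P - real Q"] by (simp add: m power2_eq_square algebra_simps)
      moreover have "\<delta> * (real m + 2)\<^sup>2 \<le> \<delta> * N\<^sup>2"
        using \<delta> by (intro mult_left_mono power_mono) (auto simp: N)
      then have "\<delta> / 4 * (real m + 2)\<^sup>2 \<le> real p * real q" using prod by simp
      moreover have "(real m + 2)\<^sup>2 > 0" by simp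
      ultimately have "\<delta> / 4 \<le> real p * real q / (real m + 2)\<^sup>2" "real p * real q / (real m + 2)\<^sup>2 \<le> 2"
        by (simp_all only: pos_le_divide_eq pos_divide_le_eq)
      moreover have "real p = 2 * real P + 1" "real q = 2 * real Q + 1" using 4 by auto
      then have "kraw_mass p q ((p + q) div 2) = B * (real p * real q / (real m + 2)\<^sup>2)"
        using mass(4) unfolding c by (simp only: 4[symmetric])
      ultimately show thesis by (intro that)
    qed
  qed
  have "1 / N * (\<delta> / 4) \<le> B * r" using B_lower r \<delta> B0 by (intro mult_mono) auto
  then show "\<delta> / 4 / real (p + q) \<le> kraw_mass p q ((p + q) div 2)"
    unfolding r N_def[symmetric] by simp
  have "B * r \<le> 2 / \<delta> / N * 2" using B_upper r \<delta> B0 \<open>N > 0\<close> by (intro mult_mono) auto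
  then show "kraw_mass p q ((p + q) div 2) \<le> 4 / \<delta> / real (p + q)"
    unfolding r N_def[symmetric] by simp
qed

section \<open>Transport from the middle to the whole disk\<close>

lemma in_disk_toward_center:
  assumes "in_disk \<delta> N a b" "i \<in> {a..N div 2} \<union> {N div 2..a}"
  shows "in_disk \<delta> N i b"
proof -
  have "\<bar>2 * int i - int N\<bar> \<le> \<bar>2 * int a - int N\<bar>"
  proof (cases "i = a")
    case False
    \<comment> \<open>For odd \<open>N\<close> the middle \<open>N div 2\<close> misses
      \<open>N / 2\<close> by one half; \<open>i \<noteq> a\<close> supplies the missing
      unit.\<close>
    have "int N - 1 \<le> 2 * int (N div 2)" "2 * int (N div 2) \<le> int N" by linarith+
    moreover have "int a + 1 \<le> int i \<and> int i \<le> int (N div 2) \<or> int (N div 2) \<le> int i \<and> int i + 1 \<le> int a"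
      using assms(2) False by (auto simp del: of_nat_div)
    ultimately show ?thesis by linarith
  qed simp
  then have "(2 * int i - int N)\<^sup>2 \<le> (2 * int a - int N)\<^sup>2" by (simp only: abs_le_square_iff)
  then have "real_of_int ((2 * int i - int N)\<^sup>2) \<le> real_of_int ((2 * int a - int N)\<^sup>2)"
    by (simp only: of_int_le_iff)
  then have "(2 * real i - real N)\<^sup>2 \<le> (2 * real a - real N)\<^sup>2" by simp
  then show ?thesis using assms(1) by (simp add: in_disk_def)
qed

text \<open>The energy exceeds the norm by a factor of order \<open>p + q\<close>, and
  \<open>fact (p + q - a)\<close> exceeds the factorial in the binomial coefficient by the factor
  \<open>p + q - a\<close>, of the same order. The two cancel.\<close>

lemma kraw_norm_scaled_energy:
  assumes disk: "in_disk \<delta> (p + q) a q" and \<delta>: "\<delta> > 0" and N0: "p + q > 0"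
  defines "Y \<equiv> kraw_norm p q (int a) * (fact a * fact (p + q - a))"
  shows "\<delta> / 8 * fact (p + q - 1) * kraw_scaled_energy p q a \<le> Y"
    and "Y \<le> 8 / \<delta> * fact (p + q - 1) * kraw_scaled_energy p q a"
proof -
  define N where "N = real (p + q)"
  define S where "S = kraw_energy p q a"
  define W where "W = kraw_scaled_energy p q a"
  define V where "V = kraw_norm p q (int a)"
  have N: "N > 0" unfolding N_def of_nat_0_less_iff by (rule N0)
  note bd = in_disk_bounds[OF disk \<delta> N0, folded N_def]
  have "\<delta> / 4 * N > 0" using \<delta> N by simp
  then have Na: "N - real a > 0" using bd by linarith
  then have a: "a < p + q" by (simp add: N_def)
  have f: "fact (p + q - a) = (N - real a) * fact (p + q - 1 - a)"
    using a by (subst fact_reduce) (auto simp: N_def of_nat_diff)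
  have "real ((p + q - 1) choose a) = fact (p + q - 1) / (fact a * fact (p + q - 1 - a))"
    using a by (intro binomial_fact) simp
  then have "W = S * (fact a * fact (p + q - 1 - a)) / fact (p + q - 1)"
    by (simp add: W_def S_def kraw_scaled_energy_def)
  then have SW: "fact (p + q - 1) * W * (N - real a) = S * (fact a * fact (p + q - a))"
    unfolding f by simp
  have E: "\<delta> / 8 * N * V \<le> S" "S \<le> 2 * N * V"
    using kraw_energy_bounds[OF disk \<delta> N0] by (simp_all add: N_def S_def V_def)
  have V0: "V \<ge> 0" by (simp add: V_def kraw_norm_def)
  have "0 \<le> \<delta> / 8 * N * V" using \<delta> N V0 by simp
  then have S0: "S \<ge> 0" using E by linarith
  then have W0: "W \<ge> 0" by (simp add: W_def S_def kraw_scaled_energy_def)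
  have Y: "Y = V * (fact a * fact (p + q - a))" by (simp add: Y_def V_def)
  have "N * (\<delta> / 8 * fact (p + q - 1) * W) = (1 / 2) * (fact (p + q - 1) * W) * (\<delta> / 4 * N)" by simp
  also have "\<dots> \<le> (1 / 2) * (fact (p + q - 1) * W) * (N - real a)"
    using bd W0 by (intro mult_left_mono) auto
  also have "\<dots> = (1 / 2) * (S * (fact a * fact (p + q - a)))" using SW by simp
  also have "\<dots> \<le> (1 / 2) * ((2 * N * V) * (fact a * fact (p + q - a)))"
    using E by (intro mult_left_mono mult_right_mono) auto
  also have "\<dots> = N * Y" by (simp add: Y)
  finally show "\<delta> / 8 * fact (p + q - 1) * kraw_scaled_energy p q a \<le> Y"
    using N by (simp add: W_def)
  have "\<delta> / 8 * N * Y = (\<delta> / 8 * N * V) * (fact a * fact (p + q - a))" by (simp add: Y)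
  also have "\<dots> \<le> S * (fact a * fact (p + q - a))" using E by (intro mult_right_mono) auto
  also have "\<dots> = fact (p + q - 1) * W * (N - real a)" using SW by simp
  also have "\<dots> \<le> fact (p + q - 1) * W * N" using W0 by (intro mult_left_mono) auto
  finally have "(\<delta> / 8 * Y) * N \<le> (fact (p + q - 1) * W) * N" by (simp add: mult_ac)
  then have "\<delta> / 8 * Y \<le> fact (p + q - 1) * W" using N by (simp only: mult_le_cancel_right_pos)
  then show "Y \<le> 8 / \<delta> * fact (p + q - 1) * kraw_scaled_energy p q a"
    using \<delta> by (simp add: W_def field_simps)
qed

text \<open>The chain compares the scaled energies at \<open>a\<close> and in the middle, and
  \<open>kraw_norm_scaled_energy\<close> converts them to norms at both ends.\<close>

lemma kraw_mass_bounds: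
  assumes \<delta>: "\<delta> > 0"
  obtains D N0 where "D > 0" and "\<And>p q a. in_disk \<delta> (p + q) a q \<Longrightarrow> real (p + q) \<ge> N0 \<Longrightarrow>
    1 / D / real (p + q) \<le> kraw_mass p q a \<and> kraw_mass p q a \<le> D / real (p + q)"
proof -
  define E where "E = exp (768 / \<delta> ^ 3)"
  \<comment> \<open>\<open>64 / \<delta> ^ 2\<close> for the two conversions, \<open>E\<close> for
    the chain, \<open>4 / \<delta>\<close> for the middle.\<close>
  define D where "D = 256 * E / \<delta> ^ 3"
  define N0 where "N0 = max 1 (max (16 / \<delta>) (768 / \<delta> ^ 3))"
  have E0: "E > 0" by (simp add: E_def)
  then have "D > 0" using \<delta> by (simp add: D_def)
  moreover have "1 / D / real (p + q) \<le> kraw_mass p q a \<and> kraw_mass p q a \<le> D / real (p + q)"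
    if disk: "in_disk \<delta> (p + q) a q" and large: "real (p + q) \<ge> N0" for p q a
  proof -
    define m where "m = (p + q) div 2"
    define N where "N = real (p + q)"
    define F where "F = (fact (p + q - 1) :: real)"
    define W where "W = kraw_scaled_energy p q"
    define Y where "Y i = kraw_norm p q (int i) * (fact i * fact (p + q - i))" for i
    have N: "N \<ge> 1" "N \<ge> 16 / \<delta>" "N \<ge> 768 / \<delta> ^ 3" using large by (auto simp: N_def N0_def)
    then have N0: "p + q > 0" unfolding N_def by linarith
    have diskm: "in_disk \<delta> (p + q) m q"
      by (rule in_disk_toward_center[OF disk]) (auto simp: m_def)
    have a: "a \<le> p + q" using in_disk_bounds(2)[OF disk \<delta> N0] \<delta> N
      by (smt (verit) N_def divide_pos_pos mult_pos_pos of_nat_le_iff)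
    have chain: "W a \<le> E * W m" "W m \<le> E * W a"
      using kraw_scaled_energy_chain[of a m \<delta> p q] kraw_scaled_energy_chain[of m a \<delta> p q]
        in_disk_toward_center[OF disk] \<delta> N a
      by (cases "a \<le> m"; auto simp: W_def E_def m_def N_def)+
    note Ya = kraw_norm_scaled_energy[OF disk \<delta> N0, folded F_def W_def Y_def]
    note Ym = kraw_norm_scaled_energy[OF diskm \<delta> N0, folded F_def W_def Y_def]
    have F0: "F > 0" by (simp add: F_def)
    have aux: "y \<le> 64 * E / \<delta>\<^sup>2 * z" if "y \<le> 8 / \<delta> * F * v" "v \<le> E * w" "\<delta> / 8 * F * w \<le> z" for y z v w
    proof -
      have "8 / \<delta> * F * v \<le> 8 / \<delta> * F * (E * w)" using that(2) F0 \<delta> by (intro mult_left_mono) auto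
      also have "\<dots> = 64 * E / \<delta>\<^sup>2 * (\<delta> / 8 * F * w)" using \<delta> by (simp add: field_simps power2_eq_square)
      also have "\<dots> \<le> 64 * E / \<delta>\<^sup>2 * z" using that(3) E0 by (intro mult_left_mono) auto
      finally show ?thesis using that(1) by linarith
    qed
    have YY: "Y a \<le> 64 * E / \<delta>\<^sup>2 * Y m" "Y m \<le> 64 * E / \<delta>\<^sup>2 * Y a"
      using aux[OF Ya(2) chain(1) Ym(1)] aux[OF Ym(2) chain(2) Ya(1)] .
    define Z where "Z = (fact p * fact q * 2 ^ (p + q) :: real)"
    have Z0: "Z > 0" by (simp add: Z_def)
    have mass: "kraw_mass p q i = Y i / Z" for i by (simp add: kraw_mass_def Y_def Z_def)
    have MM: "kraw_mass p q a \<le> 64 * E / \<delta>\<^sup>2 * kraw_mass p q m" "kraw_mass p q m \<le> 64 * E / \<delta>\<^sup>2 * kraw_mass p q a"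
      using divide_right_mono[OF YY(1), of Z] divide_right_mono[OF YY(2), of Z] Z0 by (simp_all add: mass)
    have "real (p + q) \<ge> 16 / \<delta>" using N by (simp add: N_def)
    note center = kraw_mass_center_bounds[OF disk \<delta> this, folded m_def N_def]
    have "kraw_mass p q a \<le> 64 * E / \<delta>\<^sup>2 * (4 / \<delta> / N)"
      using MM(1) mult_left_mono[OF center(2), of "64 * E / \<delta>\<^sup>2"] E0 by simp
    also have "\<dots> = D / N" by (simp add: D_def power2_eq_square power3_eq_cube)
    finally have "kraw_mass p q a \<le> D / N" .
    moreover have "\<delta> / 4 / N \<le> 64 * E / \<delta>\<^sup>2 * kraw_mass p q a" using MM(2) center(1) by linarith
    then have "1 / D / N \<le> kraw_mass p q a"
      using E0 \<delta> N(1) by (simp add: D_def field_simps power2_eq_square power3_eq_cube)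
    ultimately show ?thesis by (simp add: N_def)
  qed
  ultimately show thesis using that by blast
qed

section \<open>Two-sided bounds for the increments\<close>

text \<open>Both \<open>2 * a - N\<close> and \<open>2 * b - N\<close> move by at most 3, so the
  left side of \<open>in_disk\<close> grows by \<open>O(N)\<close>, whereas halving the margin frees
  about \<open>\<delta> / 2 * N ^ 2\<close>, and \<open>\<delta> * N \<ge> 64\<close>.\<close>

lemma in_disk_perturb:
  assumes disk: "in_disk \<delta> N a b" and \<delta>: "\<delta> > 0" and large: "real N \<ge> 64 / \<delta>"
    and a: "\<bar>real a' - real a\<bar> \<le> 1" and b: "\<bar>real b' - real b\<bar> \<le> 1" and N': "\<bar>real N' - real N\<bar> \<le> 1"
  shows "in_disk (\<delta> / 2) N' a' b'"
proof -
  define n where "n = real N"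
  define x where "x = 2 * real a - n"
  define y where "y = 2 * real b - n"
  define x' where "x' = 2 * real a' - real N'"
  define y' where "y' = 2 * real b' - real N'"
  have "64 / \<delta> > 0" using \<delta> by simp
  then have n: "n > 0" "N > 0" using large by (auto simp: n_def intro: gr0I)
  then have \<delta>1: "\<delta> \<le> 1" using in_disk_bounds(3)[OF disk \<delta>] by simp
  have n64: "64 \<le> \<delta> * n" using large \<delta> by (simp add: n_def field_simps)
  also have "\<dots> \<le> 1 * n" using \<delta>1 n by (intro mult_right_mono) auto
  finally have "n \<ge> 64" by simp
  have xy: "x\<^sup>2 + y\<^sup>2 \<le> (1 - \<delta>) * n\<^sup>2" using disk by (simp add: in_disk_def x_def y_def n_def)
  also have "\<dots> \<le> 1 * n\<^sup>2" using \<delta> by (intro mult_right_mono) auto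
  finally have xy1: "x\<^sup>2 + y\<^sup>2 \<le> n\<^sup>2" by simp
  have "x\<^sup>2 \<le> n\<^sup>2" "y\<^sup>2 \<le> n\<^sup>2" using xy1 zero_le_power2[of x] zero_le_power2[of y] by linarith+
  then have xn: "\<bar>x\<bar> \<le> n" "\<bar>y\<bar> \<le> n" using n abs_le_square_iff[of x n] abs_le_square_iff[of y n] by auto
  have shift: "z'\<^sup>2 \<le> z\<^sup>2 + 6 * n + 9" if "\<bar>z' - z\<bar> \<le> 3" "\<bar>z\<bar> \<le> n" for z z' :: real
  proof -
    have "\<bar>z'\<bar> \<le> \<bar>z\<bar> + 3" using that by linarith
    then have "\<bar>z'\<bar>\<^sup>2 \<le> (\<bar>z\<bar> + 3)\<^sup>2" by (intro power_mono) auto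
    then have "z'\<^sup>2 \<le> z\<^sup>2 + 6 * \<bar>z\<bar> + 9" by (simp add: power2_sum)
    then show ?thesis using that by linarith
  qed
  have "\<bar>x' - x\<bar> \<le> 3" "\<bar>y' - y\<bar> \<le> 3"
    using a b N' unfolding x'_def y'_def x_def y_def n_def by linarith+
  then have "x'\<^sup>2 \<le> x\<^sup>2 + 6 * n + 9" "y'\<^sup>2 \<le> y\<^sup>2 + 6 * n + 9"
    using xn by (auto intro: shift)
  then have "x'\<^sup>2 + y'\<^sup>2 \<le> (1 - \<delta>) * n\<^sup>2 + 12 * n + 18" using xy by linarith
  also have "\<dots> \<le> (1 - \<delta> / 2) * (n - 1)\<^sup>2"
  proof -
    define A where "A = \<delta> * n * n"
    define B where "B = \<delta> * n"
    have "64 * n \<le> A" unfolding A_def using n64 n by (intro mult_right_mono) auto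
    moreover have "0 \<le> B" using \<delta> n by (simp add: B_def)
    ultimately have "0 \<le> A / 2 + B - \<delta> / 2 - 14 * n - 17" using \<open>n \<ge> 64\<close> \<delta>1 by linarith
    moreover have "(1 - \<delta> / 2) * (n - 1)\<^sup>2
        = (1 - \<delta>) * n\<^sup>2 + 12 * n + 18 + (A / 2 + B - \<delta> / 2 - 14 * n - 17)"
      by (simp add: A_def B_def power2_eq_square algebra_simps)
    ultimately show ?thesis by linarith
  qed
  also have "\<dots> \<le> (1 - \<delta> / 2) * (real N')\<^sup>2"
    using N' \<delta>1 \<open>n \<ge> 64\<close> by (intro mult_left_mono power_mono) (auto simp: n_def)
  finally show ?thesis by (simp add: in_disk_def x'_def y'_def)
qed

lemma norm_gauge_b: "(cmod (gauge_b N a b))\<^sup>2 = kraw_norm (N - b) b a"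
  by (simp add: gauge_b_def kraw_norm_def cmod_power2)

lemma norm_gauge_w: "(cmod (gauge_w N a b))\<^sup>2 = kraw_norm (N - a) a b / 4 ^ Suc N"
proof -
  have "(2 ^ Suc N)\<^sup>2 = (4 ^ Suc N :: real)"
    by (simp add: power2_eq_square flip: power_mult_distrib)
  moreover have "cmod (gauge_w N a b) = cmod (Complex (krawtchouk (N - a) a b) (krawtchouk (N - a) a (b + 1))) / 2 ^ Suc N"
    by (simp add: gauge_w_def norm_divide norm_power)
  ultimately show ?thesis by (simp add: kraw_norm_def cmod_power2 power_divide)
qed

definition comparable :: "real \<Rightarrow> real \<Rightarrow> real \<Rightarrow> bool" where
  "comparable D x y \<longleftrightarrow> y / D \<le> x \<and> x \<le> D * y"

lemma comparable_mult:
  assumes "comparable D x y" "comparable D' x' y'" "D > 0" "D' > 0" "y \<ge> 0" "y' \<ge> 0"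
  shows "comparable (D * D') (x * x') (y * y')"
proof -
  have xy: "0 \<le> y / D" "y / D \<le> x" "x \<le> D * y" "0 \<le> y' / D'" "y' / D' \<le> x'" "x' \<le> D' * y'"
    using assms by (auto simp: comparable_def)
  then have "0 \<le> x" "0 \<le> x'" by linarith+
  then have "(y / D) * (y' / D') \<le> x * x'" "x * x' \<le> (D * y) * (D' * y')"
    using xy by (auto intro!: mult_mono simp del: times_divide_eq_left times_divide_eq_right divide_divide_eq_left)
  then show ?thesis by (simp add: comparable_def mult_ac)
qed

text \<open>The weight \<open>w\<close> turns squared black moduli into values of
  \<open>kraw_mass\<close> up to bounded factors, and its inverse does so for the white ones. The
  black value at level \<open>N - 1\<close> serves the hexagon diagonals.\<close>

lemma gauge_bounds:
  assumes \<delta>: "\<delta> > 0"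
  obtains D N0 where "D > 0" and "\<And>N a b. in_disk \<delta> N a b \<Longrightarrow> real N \<ge> N0 \<Longrightarrow>
    (\<exists>w>0. (\<forall>x\<in>{gauge_b N (int a) b, gauge_b N (int a - 1) b, gauge_b (N - 1) (int a - 1) b}.
              comparable D ((cmod x)\<^sup>2 * w / 2 ^ N) (1 / real N)) \<and>
           (\<forall>y\<in>{gauge_w N a (int b), gauge_w N a (int b - 1)}.
              comparable D (4 * (cmod y)\<^sup>2 * 2 ^ N / w) (1 / real N)))"
proof -
  obtain D N1 where D: "D > 0" and mass: "\<And>p q a. in_disk (\<delta> / 2) (p + q) a q \<Longrightarrow> real (p + q) \<ge> N1 \<Longrightarrow>
    1 / D / real (p + q) \<le> kraw_mass p q a \<and> kraw_mass p q a \<le> D / real (p + q)"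
    using kraw_mass_bounds[of "\<delta> / 2"] \<delta> by auto
  define N0 where "N0 = max (N1 + 1) (64 / \<delta>)"
  \<comment> \<open>\<open>2 * D\<close> allows for level \<open>N - 1\<close> in place of
    \<open>N\<close>, and \<open>8 / \<delta>\<close> for the quotients caused by index
    shifts.\<close>
  define E where "E = (2 * D) * (8 / \<delta>)"
  have "E > 0" using D \<delta> by (simp add: E_def)
  moreover have "\<exists>w>0. (\<forall>x\<in>{gauge_b N (int a) b, gauge_b N (int a - 1) b, gauge_b (N - 1) (int a - 1) b}.
              comparable E ((cmod x)\<^sup>2 * w / 2 ^ N) (1 / real N)) \<and>
           (\<forall>y\<in>{gauge_w N a (int b), gauge_w N a (int b - 1)}.
              comparable E (4 * (cmod y)\<^sup>2 * 2 ^ N / w) (1 / real N))"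
    if disk: "in_disk \<delta> N a b" and large: "real N \<ge> N0" for N a b
  proof -
    define n where "n = real N"
    \<comment> \<open>The quotient of \<open>N choose b\<close> by
      \<open>N choose a\<close>.\<close>
    define w where "w = (fact a * fact (N - a) / (fact b * fact (N - b)) :: real)"
    have w: "w > 0" by (simp add: w_def)
    have n1: "n \<ge> N1 + 1" "n \<ge> 64 / \<delta>" using large by (auto simp: n_def N0_def)
    have "64 / \<delta> > 0" using \<delta> by simp
    then have n: "n > 0" "N > 0" using n1 by (auto simp: n_def intro: gr0I)
    note bd = in_disk_bounds[OF disk \<delta> n(2), folded n_def]
    note bd' = in_disk_bounds[OF disk[THEN in_disk_commute[THEN iffD1]] \<delta> n(2), folded n_def]
    have "64 \<le> \<delta> * n" using n1 \<delta> by (simp add: field_simps)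
    then have dn: "16 \<le> \<delta> / 4 * n" by simp
    have ab: "a \<ge> 1" "b \<ge> 1" "a < N" "b < N" using bd bd' dn by (auto simp: n_def)
    have "\<delta> * n \<le> 1 * n" using bd(3) n by (intro mult_right_mono) auto
    then have n64: "n \<ge> 64" using \<open>64 \<le> \<delta> * n\<close> by simp
    have perturb: "in_disk (\<delta> / 2) N' a' b'"
      if "\<bar>real a' - real a\<bar> \<le> 1" "\<bar>real b' - real b\<bar> \<le> 1" "\<bar>real N' - real N\<bar> \<le> 1" for a' b' N'
      using in_disk_perturb[OF disk \<delta> _ that] n1 by (simp add: n_def)
    have massN: "comparable (2 * D) (kraw_mass (N' - b') b' a') (1 / n)"
      if "\<bar>real a' - real a\<bar> \<le> 1" "\<bar>real b' - real b\<bar> \<le> 1" "\<bar>real N' - real N\<bar> \<le> 1" "b' \<le> N'" "N' \<le> N" for a' b' N'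
    proof -
      have m: "1 / D / real N' \<le> kraw_mass (N' - b') b' a'" "kraw_mass (N' - b') b' a' \<le> D / real N'"
        using mass[of "N' - b'" b' a'] perturb[OF that(1-3)] that(3,4) n1(1) by (auto simp: n_def)
      have N': "n \<le> 2 * real N'" "real N' > 0" using that(3) n64 by (auto simp: n_def)
      have "D / real N' \<le> 2 * D * (1 / n)" using N' n D by (simp add: field_simps)
      moreover have "1 / n / (2 * D) \<le> 1 / D / real N'"
        using N' n D that(5) by (simp add: n_def frac_le field_simps)
      ultimately show ?thesis unfolding comparable_def using m by linarith
    qed
    have massA: "comparable (2 * D) (kraw_mass (N - a') a' b') (1 / n)"
      if "\<bar>real a' - real a\<bar> \<le> 1" "\<bar>real b' - real b\<bar> \<le> 1" "a' \<le> N" for a' b'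
    proof -
      have m: "1 / D / real N \<le> kraw_mass (N - a') a' b'" "kraw_mass (N - a') a' b' \<le> D / real N"
        using mass[of "N - a'" a' b'] perturb[OF that(1,2), of N] that(3) n1(1) in_disk_commute by (auto simp: n_def)
      have "D / n \<le> 2 * D * (1 / n)" "1 / n / (2 * D) \<le> 1 / D / n"
        using n D by (simp_all add: field_simps)
      then show ?thesis unfolding comparable_def using m unfolding n_def by linarith
    qed
    \<comment> \<open>The quotient of factorials when \<open>a\<close> or \<open>b\<close> is
      lowered by one; \<open>ratio'\<close> is the quotient, powers of two included, when
      \<open>a\<close> and \<open>N\<close> are lowered together.\<close>
    have ratio: "comparable (8 / \<delta>) (real i / (n + 1 - real i)) 1"
      if "\<delta> / 4 * n \<le> real i" "\<delta> / 4 * n \<le> n - real i" for i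
    proof -
      have i: "real i \<le> n" "n + 1 - real i > 0" using that dn by linarith+
      have "\<delta> / 8 * (n + 1 - real i) \<le> \<delta> / 8 * (2 * n)" using n64 \<delta> by (intro mult_left_mono) auto
      then have "\<delta> / 8 * (n + 1 - real i) \<le> real i" using that by simp
      moreover have "8 / \<delta> * (n + 1 - real i) \<ge> 8 / \<delta> * (\<delta> / 4 * n)"
        using that \<delta> by (intro mult_left_mono) auto
      then have "real i \<le> 8 / \<delta> * (n + 1 - real i)" using i n \<delta> by simp
      ultimately show ?thesis unfolding comparable_def using i(2) \<delta>
        by (simp add: pos_le_divide_eq pos_divide_le_eq)
    qed
    have ratio': "comparable (8 / \<delta>) (real a / (2 * (n - real b))) 1"
    proof -
      have "16 \<le> n - real b" "16 \<le> n - real a" using dn bd(2) bd'(2) by (auto intro: order_trans)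
      then have pos: "2 * (n - real b) > 0" "real a \<le> n" by simp_all
      have "\<delta> / 8 * (2 * (n - real b)) \<le> \<delta> / 8 * (2 * n)" using \<delta> by (intro mult_left_mono) auto
      then have "\<delta> / 8 * (2 * (n - real b)) \<le> real a" using bd(1) by simp
      moreover have "8 / \<delta> * (2 * (n - real b)) \<ge> 8 / \<delta> * (2 * (\<delta> / 4 * n))"
        using bd'(2) \<delta> by (intro mult_left_mono) auto
      then have "real a \<le> 8 / \<delta> * (2 * (n - real b))" using pos(2) n \<delta> by simp
      ultimately show ?thesis unfolding comparable_def using pos \<delta>
        by (simp add: pos_le_divide_eq pos_divide_le_eq)
    qed
    have combine: "comparable E (x * r) (1 / n)" if "comparable (2 * D) x (1 / n)" "comparable (8 / \<delta>) r 1" for x r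
      using comparable_mult[OF that] D \<delta> n by (simp add: E_def)
    have one: "comparable (8 / \<delta>) 1 1" using \<delta> bd(3) by (simp add: comparable_def)
    have fa: "fact a = real a * fact (a - 1)" "fact b = real b * fact (b - 1)"
      using ab by (simp_all add: fact_reduce)
    define u1 where "u1 = n + 1 - real a"
    define u2 where "u2 = n + 1 - real b"
    define u3 where "u3 = n - real b"
    have fNa: "fact (N - (a - 1)) = u1 * fact (N - a)" "fact (N - (b - 1)) = u2 * fact (N - b)"
      "fact (N - b) = u3 * fact (N - 1 - b)"
      using ab by (subst fact_reduce; simp add: u1_def u2_def u3_def n_def of_nat_diff Suc_diff_le)+
    have nz: "u1 > 0" "u2 > 0" "u3 > 0" using ab by (auto simp: u1_def u2_def u3_def n_def)
    have w2: "(2::real) ^ N = 2 * 2 ^ (N - 1)" using n(2) by (cases N) auto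
    have four: "(4::real) ^ N = 2 ^ N * 2 ^ N" by (simp add: power_mult_distrib[symmetric])
    have N1: "N - (N - a) = a" "N - (N - b) = b" "N - 1 - b + b = N - 1" "N - 1 - (a - 1) = N - a"
      "N - b + b = N" "N - a + a = N" using ab by auto
    have ia: "int a - 1 = int (a - 1)" "int b - 1 = int (b - 1)" using ab by auto
    have "(cmod (gauge_b N (int a) b))\<^sup>2 * w / 2 ^ N = kraw_mass (N - b) b a * 1"
      unfolding norm_gauge_b kraw_mass_def w_def N1 by (simp add: field_simps)
    moreover have "(cmod (gauge_b N (int a - 1) b))\<^sup>2 * w / 2 ^ N
        = kraw_mass (N - b) b (a - 1) * (real a / (n + 1 - real a))"
      unfolding norm_gauge_b kraw_mass_def w_def N1 ia fNa(1) fa(1) u1_def[symmetric] using nz by (simp add: field_simps)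
    moreover have "(cmod (gauge_b (N - 1) (int a - 1) b))\<^sup>2 * w / 2 ^ N
        = kraw_mass (N - 1 - b) b (a - 1) * (real a / (2 * (n - real b)))"
      unfolding norm_gauge_b kraw_mass_def w_def N1 ia fNa(3) fa(1) w2 u3_def[symmetric] using nz by (simp add: field_simps)
    moreover have "4 * (cmod (gauge_w N a (int b)))\<^sup>2 * 2 ^ N / w = kraw_mass (N - a) a b * 1"
      unfolding norm_gauge_w kraw_mass_def w_def N1 power_Suc four by (simp add: field_simps)
    moreover have "4 * (cmod (gauge_w N a (int b - 1)))\<^sup>2 * 2 ^ N / w
        = kraw_mass (N - a) a (b - 1) * (real b / (n + 1 - real b))"
      unfolding norm_gauge_w kraw_mass_def w_def N1 ia fNa(2) fa(2) power_Suc four u2_def[symmetric] using nz by (simp add: field_simps)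
    moreover have "real (a - 1) = real a - 1" "real (b - 1) = real b - 1" "real (N - 1) = real N - 1" using ab n(2) by auto
    moreover have "b \<le> N - 1" using ab by simp
    ultimately show ?thesis
      using w combine[OF massN[of a b N] one] combine[OF massN[of "a - 1" b N] ratio[of a]]
        combine[OF massN[of "a - 1" b "N - 1"] ratio'] combine[OF massA[of a b] one]
        combine[OF massA[of a "b - 1"] ratio[of b]] bd bd' ab
      by (intro exI[of _ w]) (auto simp: n_def[symmetric])
  qed
  ultimately show thesis using that by blast
qed

text \<open>By the factorization each difference is, up to sign, the product of a black and a white
  value from \<open>gauge_bounds\<close>, or twice such a product.\<close>

lemma grid_F_bounds:
  assumes \<delta>: "\<delta> > 0"
  obtains C N0 where "C > 0" and "\<And>N a b z. in_disk \<delta> N a b \<Longrightarrow> real N \<ge> N0 \<Longrightarrow>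
    z \<in> {grid_F (Suc N) (Suc a) (Suc b), grid_F (Suc N) (Suc a) b, grid_F (Suc N) a b,
         grid_F (Suc N) a (Suc b), grid_F N a (Suc b)} \<Longrightarrow>
    1 / C / real N \<le> cmod (z - grid_F N a b) \<and> cmod (z - grid_F N a b) \<le> C / real N"
proof -
  obtain D N1 where D: "D > 0" and gauge: "\<And>N a b. in_disk \<delta> N a b \<Longrightarrow> real N \<ge> N1 \<Longrightarrow>
    (\<exists>w>0. (\<forall>x\<in>{gauge_b N (int a) b, gauge_b N (int a - 1) b, gauge_b (N - 1) (int a - 1) b}.
              comparable D ((cmod x)\<^sup>2 * w / 2 ^ N) (1 / real N)) \<and>
           (\<forall>y\<in>{gauge_w N a (int b), gauge_w N a (int b - 1)}.
              comparable D (4 * (cmod y)\<^sup>2 * 2 ^ N / w) (1 / real N)))"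
    using gauge_bounds[OF \<delta>] by blast
  define N0 where "N0 = max N1 (max 1 (8 / \<delta>))"
  have "1 / (2 * D) / real N \<le> cmod (z - grid_F N a b) \<and> cmod (z - grid_F N a b) \<le> 2 * D / real N"
    if disk: "in_disk \<delta> N a b" and large: "real N \<ge> N0"
      and z: "z \<in> {grid_F (Suc N) (Suc a) (Suc b), grid_F (Suc N) (Suc a) b, grid_F (Suc N) a b,
         grid_F (Suc N) a (Suc b), grid_F N a (Suc b)}" for N a b z
  proof -
    have N: "real N > 0" "N > 0" using large by (auto simp: N0_def)
    have "8 \<le> \<delta> * real N" using large \<delta> by (simp add: N0_def field_simps)
    then have "2 \<le> \<delta> / 4 * real N" by simp
    then have "2 \<le> real a" "2 \<le> real N - real a" "2 \<le> real b" "2 \<le> real N - real b"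
      using in_disk_bounds(1,2)[OF disk \<delta> N(2)]
        in_disk_bounds(1,2)[OF disk[THEN in_disk_commute[THEN iffD1]] \<delta> N(2)] by linarith+
    then have ab: "1 \<le> a" "a < N" "1 \<le> b" "b < N" by auto
    have "real N \<ge> N1" using large by (simp add: N0_def)
    from gauge[OF disk this] obtain w where w: "w > 0"
      and x: "\<And>x. x\<in>{gauge_b N (int a) b, gauge_b N (int a - 1) b, gauge_b (N - 1) (int a - 1) b} \<Longrightarrow>
              comparable D ((cmod x)\<^sup>2 * w / 2 ^ N) (1 / real N)"
      and y: "\<And>y. y\<in>{gauge_w N a (int b), gauge_w N a (int b - 1)} \<Longrightarrow>
              comparable D (4 * (cmod y)\<^sup>2 * 2 ^ N / w) (1 / real N)" by blast
    have xy: "1 / D / real N \<le> 2 * cmod (x * y) \<and> 2 * cmod (x * y) \<le> D / real N"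
      if "x\<in>{gauge_b N (int a) b, gauge_b N (int a - 1) b, gauge_b (N - 1) (int a - 1) b}"
        "y\<in>{gauge_w N a (int b), gauge_w N a (int b - 1)}" for x y
    proof -
      have "comparable (D * D) ((cmod x)\<^sup>2 * w / 2 ^ N * (4 * (cmod y)\<^sup>2 * 2 ^ N / w)) (1 / real N * (1 / real N))"
        by (rule comparable_mult[OF x[OF that(1)] y[OF that(2)]]) (use D N in auto)
      \<comment> \<open>The weight and the powers of two cancel here.\<close>
      also have "(cmod x)\<^sup>2 * w / 2 ^ N * (4 * (cmod y)\<^sup>2 * 2 ^ N / w) = (2 * cmod (x * y))\<^sup>2"
        using w by (simp add: norm_mult power_mult_distrib)
      finally have "(1 / D / real N)\<^sup>2 \<le> (2 * cmod (x * y))\<^sup>2" "(2 * cmod (x * y))\<^sup>2 \<le> (D / real N)\<^sup>2"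
        by (simp_all add: comparable_def power2_eq_square field_simps)
      then show ?thesis using power2_le_imp_le D N by (metis divide_nonneg_nonneg norm_ge_zero mult_nonneg_nonneg zero_le_numeral less_imp_le)
    qed
    \<comment> \<open>The hexagon diagonal is \<open>grid_F_diagonal\<close> one level lower, based
      at \<open>(a - 1, b)\<close>.\<close>
    obtain N' a' where suc: "N = Suc N'" "a = Suc a'" using N(2) ab(1) by (metis Suc_pred less_le_trans zero_less_one)
    have diag: "grid_F N a (Suc b) - grid_F N a b = 2 * (gauge_b (N - 1) (int a - 1) b * gauge_w N a (int b))"
      using grid_F_diagonal[of a' N' b] ab unfolding suc by simp
    define p1 where "p1 = gauge_b N (int a) b"
    define p2 where "p2 = gauge_b N (int a - 1) b"
    define p3 where "p3 = gauge_b (N - 1) (int a - 1) b"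
    define q1 where "q1 = gauge_w N a (int b)"
    define q2 where "q2 = gauge_w N a (int b - 1)"
    have "z - grid_F N a b \<in> {p1 * q1, p1 * q2, - (p2 * q2), p2 * q1, 2 * (p3 * q1)}"
      using z diag grid_F_increment[of a N b] ab unfolding p1_def p2_def p3_def q1_def q2_def by auto
    then obtain x y where "x \<in> {p1, p2, p3}" "y \<in> {q1, q2}"
        "z - grid_F N a b \<in> {x * y, - (x * y), 2 * (x * y)}" by blast
    moreover note xy = xy[folded p1_def p2_def p3_def q1_def q2_def]
    ultimately have *: "1 / D / real N \<le> 2 * cmod (x * y)" "2 * cmod (x * y) \<le> D / real N"
      "cmod (z - grid_F N a b) = cmod (x * y) \<or> cmod (z - grid_F N a b) = 2 * cmod (x * y)"
      using xy[of x y] by (auto simp: norm_mult)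
    define p where "p = cmod (x * y)"
    define q where "q = 1 / D / real N"
    define q' where "q' = D / real N"
    have "q \<ge> 0" "q' \<ge> 0" using D by (simp_all add: q_def q'_def)
    \<comment> \<open>The bounds are for twice the product. The diagonal equals that, the other
      increments half of it; the constant \<open>2 * D\<close> covers both.\<close>
    with * have "q / 2 \<le> cmod (z - grid_F N a b)" "cmod (z - grid_F N a b) \<le> 2 * q'"
      unfolding p_def[symmetric] q_def[symmetric] q'_def[symmetric] by auto
    then show ?thesis by (simp add: q_def q'_def)
  qed
  then show thesis using that[of "2 * D" N0] D by simp
qed

section \<open>The rank of a face\<close>

text \<open>The three pieces match at -1 and at \<open>x_star f\<close>, and each is 1-Lipschitz,
  the middle one by its derivative bound; points in different pieces are compared through the break
  points.\<close>

lemma fbar_lipschitz: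
  assumes "admissible f"
  shows "\<bar>fbar f x - fbar f y\<bar> \<le> \<bar>x - y\<bar>"
proof -
  define xs where "xs = x_star f"
  obtain z where "smallest_fixpoint f z" using assms by (auto simp: admissible_def)
  then have "smallest_fixpoint f xs" using x_star_eq by (simp add: xs_def)
  then have xs: "-1 < xs" "f xs = xs" by (auto simp: smallest_fixpoint_def)
  have f1: "f (-1) = 1" using assms by (simp add: admissible_def)
  have L: "\<bar>f u - f v\<bar> \<le> \<bar>u - v\<bar>" if "u \<in> {-1..xs}" "v \<in> {-1..xs}" for u v
  proof -
    have "norm (f u - f v) \<le> 1 * norm (u - v)"
    proof (rule field_differentiable_bound[where S = "{-1..xs}" and f' = "deriv f"])
      fix z assume z: "z \<in> {-1..xs}"
      then have "f differentiable (at z)" "\<bar>deriv f z\<bar> \<le> 1"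
        using assms by (auto simp: admissible_def xs_def)
      then show "(f has_field_derivative deriv f z) (at z within {-1..xs})" "norm (deriv f z) \<le> 1"
        by (auto intro: has_field_derivative_at_within simp: DERIV_deriv_iff_real_differentiable)
    qed (use that in auto)
    then show ?thesis by simp
  qed
  have mono: "\<bar>fbar f x - fbar f y\<bar> \<le> y - x" if "x \<le> y" for x y
    using that L[of x y] L[of "-1" y] L[of x xs] L[of "-1" xs] xs f1
    unfolding fbar_def xs_def[symmetric]
    by (auto simp: abs_le_iff)
  show ?thesis
  proof (cases "x \<le> y")
    case True
    then show ?thesis using mono[of x y] by simp
  next
    case False
    then show ?thesis using mono[of y x] by (simp add: abs_minus_commute)
  qed
qed

lemma path_interp_of_int: "path_interp H (of_int c) = of_int (H c)"
  by (simp add: path_interp_def)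

text \<open>The formula takes in each column the largest value of the right parity that the bound
  allows there. The Lipschitz estimate turns these separate maxima into a path, which is then the
  greatest one.\<close>

lemma tower_path_eq:
  assumes "admissible f"
  defines "G \<equiv> \<lambda>n t. (real n + 1) * fbar f (t / (real n + 1))"
  shows "tower_path f n = (\<lambda>c. c + 2 * \<lfloor>(G n (of_int c) - of_int c) / 2\<rfloor> - 1)"
    and "up_down_path (tower_path f n)"
proof -
  define H where "H = (\<lambda>c. c + 2 * \<lfloor>(G n (of_int c) - of_int c) / 2\<rfloor> - 1)"
  have G: "\<bar>G n s - G n t\<bar> \<le> \<bar>s - t\<bar>" for s t
  proof -
    have "\<bar>G n s - G n t\<bar> = (real n + 1) * \<bar>fbar f (s / (real n + 1)) - fbar f (t / (real n + 1))\<bar>"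
      unfolding G_def right_diff_distrib[symmetric] abs_mult by simp
    also have "\<dots> \<le> (real n + 1) * \<bar>s / (real n + 1) - t / (real n + 1)\<bar>"
      by (intro mult_left_mono fbar_lipschitz assms) auto
    also have "\<dots> = \<bar>(real n + 1) * (s / (real n + 1) - t / (real n + 1))\<bar>"
      by (simp add: abs_mult)
    also have "(real n + 1) * (s / (real n + 1) - t / (real n + 1)) = s - t"
    proof -
      have "real n + 1 \<noteq> 0" by linarith
      then show ?thesis unfolding right_diff_distrib by simp
    qed
    finally show ?thesis .
  qed
  \<comment> \<open>Half of \<open>G n c - c\<close> does not increase and drops by at most 1 per
    column. Its floor stays, which is a step up, or falls by one, a step down.\<close>
  have step: "H (c + 1) - H c = 1 \<or> H (c + 1) - H c = -1" for c
  proof -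
    define x where "x = (G n (of_int c) - of_int c) / 2"
    define y where "y = (G n (of_int (c + 1)) - of_int (c + 1)) / 2"
    have "x - 1 \<le> y" "y \<le> x" using G[of "of_int (c + 1)" "of_int c"] by (auto simp: x_def y_def abs_le_iff field_simps)
    then have "\<lfloor>y\<rfloor> = \<lfloor>x\<rfloor> \<or> \<lfloor>y\<rfloor> = \<lfloor>x\<rfloor> - 1" by linarith
    then show ?thesis unfolding H_def x_def[symmetric] y_def[symmetric] by auto
  qed
  have H_le: "of_int (H c) + 1 \<le> G n (of_int c)" for c
  proof -
    define x where "x = (G n (of_int c) - of_int c) / 2"
    have "of_int (H c) + 1 = of_int c + 2 * real_of_int \<lfloor>x\<rfloor>" by (simp add: H_def x_def)
    moreover have "G n (of_int c) = of_int c + 2 * x" by (simp add: x_def field_simps)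
    moreover have "of_int \<lfloor>x\<rfloor> \<le> x" by (rule of_int_floor_le)
    ultimately show ?thesis by linarith
  qed
  have ud: "up_down_path H" using step by (auto simp: up_down_path_def H_def)
  have below: "path_below f n H"
    unfolding path_below_def
  proof
    fix x :: real
    define t where "t = (real n + 1) * x"
    define c where "c = \<lfloor>t\<rfloor>"
    have t: "of_int c \<le> t" "t \<le> of_int c + 1" "frac t = t - of_int c" unfolding c_def frac_def by linarith+
    \<comment> \<open>Compare from the higher end of the segment: from there the path descends with
      slope 1, and \<open>G n\<close> descends no faster.\<close>
    have "path_interp H t + 1 \<le> G n t"
      using step[of c]
    proof
      assume s: "H (c + 1) - H c = 1"
      have "path_interp H t + 1 = of_int (H c) + (t - of_int c) + 1"
        unfolding path_interp_def c_def[symmetric] s t(3) by simp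
      also have "\<dots> = of_int (H (c + 1)) + 1 - \<bar>of_int (c + 1) - t\<bar>"
        using s t by simp
      also have "\<dots> \<le> G n (of_int (c + 1)) - \<bar>of_int (c + 1) - t\<bar>" using H_le[of "c + 1"] by simp
      also have "\<dots> \<le> G n t" using G[of "of_int (c + 1)" t] by linarith
      finally show ?thesis .
    next
      assume s: "H (c + 1) - H c = -1"
      have "path_interp H t + 1 = of_int (H c) + 1 - \<bar>of_int c - t\<bar>"
        unfolding path_interp_def c_def[symmetric] s t(3) using t by simp
      also have "\<dots> \<le> G n (of_int c) - \<bar>of_int c - t\<bar>" using H_le[of c] by simp
      also have "\<dots> \<le> G n t" using G[of "of_int c" t] by linarith
      finally show ?thesis .
    qed
    moreover have "G n t = (real n + 1) * fbar f x" by (simp add: G_def t_def)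
    ultimately show "1 / (real n + 1) * (path_interp H ((real n + 1) * x) + 1) \<le> fbar f x"
      unfolding t_def[symmetric] by (simp add: field_simps)
  qed
  have greatest: "H' \<le> H" if H': "up_down_path H' \<and> path_below f n H'" for H'
  proof (rule le_funI)
    fix c
    have "1 / (real n + 1) * (path_interp H' ((real n + 1) * (of_int c / (real n + 1))) + 1)
        \<le> fbar f (of_int c / (real n + 1))"
      using H' unfolding path_below_def by blast
    moreover have "real n + 1 > 0" by linarith
    ultimately have "(of_int (H' c) + 1) / (real n + 1) \<le> fbar f (of_int c / (real n + 1))"
      by (simp add: path_interp_of_int)
    then have le: "of_int (H' c) + 1 \<le> G n (of_int c)"
      using \<open>real n + 1 > 0\<close> by (simp only: G_def pos_divide_le_eq mult.commute)
    have "odd (H' c + c)" using H' by (simp add: up_down_path_def)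
    then have "even (H' c + 1 - c)" by simp
    then obtain k where k: "H' c + 1 - c = 2 * k" by (elim evenE)
    then have "real_of_int (H' c) = of_int (2 * k + c - 1)" by (simp add: algebra_simps)
    then have "of_int k \<le> (G n (of_int c) - of_int c) / 2"
      using le by (simp add: field_simps)
    then have "k \<le> \<lfloor>(G n (of_int c) - of_int c) / 2\<rfloor>" by (simp add: le_floor_iff)
    then show "H' c \<le> H c" using k by (simp add: H_def)
  qed
  have "tower_path f n = H"
    unfolding tower_path_def by (rule Greatest_equality) (use ud below greatest in auto)
  then show "tower_path f n = (\<lambda>c. c + 2 * \<lfloor>(G n (of_int c) - of_int c) / 2\<rfloor> - 1)"
    and "up_down_path (tower_path f n)" using ud by (simp_all add: H_def)
qed

text \<open>The floor loses less than 2 and the final \<open>- 1\<close> one more.\<close>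

lemma tower_path_approx:
  assumes "admissible f"
  shows "\<bar>of_int (tower_path f n c) - (real n + 1) * fbar f (of_int c / (real n + 1))\<bar> \<le> 3"
proof -
  define g where "g = (real n + 1) * fbar f (of_int c / (real n + 1))"
  have "of_int (tower_path f n c) = of_int c + 2 * of_int \<lfloor>(g - of_int c) / 2\<rfloor> - (1::real)"
    unfolding tower_path_eq(1)[OF assms] g_def by simp
  moreover define x where "x = (g - of_int c) / 2"
  moreover have "g = of_int c + 2 * x" by (simp add: x_def field_simps)
  moreover have "of_int \<lfloor>x\<rfloor> \<le> x" "x < of_int \<lfloor>x\<rfloor> + 1" by linarith+
  ultimately show ?thesis unfolding g_def[symmetric] by linarith
qed

text \<open>Here \<open>r\<close> is the rank minus one, the level \<open>N\<close> of the grid.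
  Compactness gives a margin \<open>\<eta>\<close> in the strict quadratic inequality, worth
  \<open>\<eta> * T ^ 2\<close> after scaling, while \<open>r\<close> differs from
  \<open>T * v\<close> by a bounded amount only.\<close>

lemma liquid_region_compact_rank:
  assumes adm: "admissible f" and K: "compact K" "K \<subseteq> liquid_region f"
  obtains \<delta> \<rho> R N0 where "\<delta> > 0" "\<rho> > 0" "R > 0"
    "\<And>n j k r. real n \<ge> N0 \<Longrightarrow> (of_int j / (real n + 1), of_int k / (real n + 1)) \<in> K \<Longrightarrow>
       r = real_of_int (tower_path f (n + 1) (j + k)) - 1 \<Longrightarrow>
       \<rho> * (real n + 1) \<le> r \<and> r \<le> R * (real n + 1) \<and>
       2 * ((of_int j)\<^sup>2 + (of_int k)\<^sup>2) \<le> (1 - \<delta>) * r\<^sup>2"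
proof (cases "K = {}")
  case True
  then show thesis by (intro that[of 1 1 1 0]) auto
next
  case False
  define F where "F = fbar f"
  have lip: "\<bar>F x - F y\<bar> \<le> \<bar>x - y\<bar>" for x y unfolding F_def by (rule fbar_lipschitz[OF adm])
  have F: "F (x + y) = f (x + y)" if "(x, y) \<in> K" for x y
    using that K(2) by (auto simp: F_def fbar_def liquid_region_def)
  have contF: "continuous_on UNIV F"
  proof (rule lipschitz_on_continuous_on)
    show "1-lipschitz_on UNIV F" using lip by (auto simp: lipschitz_on_def dist_real_def)
  qed
  define \<phi> where "\<phi> = (\<lambda>p::real \<times> real. F (fst p + snd p))"
  define h where "h = (\<lambda>p. (\<phi> p)\<^sup>2 - 2 * ((fst p)\<^sup>2 + (snd p)\<^sup>2))"
  have cont\<phi>: "continuous_on K \<phi>" unfolding \<phi>_def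
    by (rule continuous_on_compose2[OF contF]) (auto intro!: continuous_intros)
  then have conth: "continuous_on K h" unfolding h_def by (intro continuous_intros)
  have pos: "\<phi> p > 0" "h p > 0" if "p \<in> K" for p
    using that K(2) F[of "fst p" "snd p"] by (auto simp: \<phi>_def h_def liquid_region_def)
  obtain \<eta> where \<eta>: "\<eta> > 0" "\<And>p. p \<in> K \<Longrightarrow> \<eta> \<le> h p"
    using continuous_attains_inf[OF K(1) False conth] pos by metis
  obtain m where m: "m > 0" "\<And>p. p \<in> K \<Longrightarrow> m \<le> \<phi> p"
    using continuous_attains_inf[OF K(1) False cont\<phi>] pos by metis
  obtain M where M: "M > 0" "\<And>p. p \<in> K \<Longrightarrow> \<phi> p \<le> M"
    using continuous_attains_sup[OF K(1) False cont\<phi>] pos by metis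
  have "continuous_on K (\<lambda>p. \<bar>fst p + snd p\<bar>)" by (intro continuous_intros)
  then obtain S where S: "S \<ge> 0" "\<And>p. p \<in> K \<Longrightarrow> \<bar>fst p + snd p\<bar> \<le> S"
    using continuous_attains_sup[OF K(1) False, of "\<lambda>p. \<bar>fst p + snd p\<bar>"] by (metis abs_ge_zero)
  \<comment> \<open>The error of \<open>r\<close> against \<open>T * v\<close>: 3 from
    \<open>tower_path_approx\<close>, 1 for the shift of the rank, \<open>S\<close> for passing from
    the scale \<open>T + 1\<close> of the path to the scale \<open>T\<close> of the faces,
    \<open>M\<close> for the surplus \<open>v\<close> in \<open>(T + 1) * v\<close>.\<close>
  define B where "B = S + M + 4"
  have B: "B > 0" using S M by (simp add: B_def)
  \<comment> \<open>As \<open>r \<le> T * (M + B)\<close>, half of \<open>\<eta>\<close> pays for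
    \<open>\<delta> * r ^ 2\<close>. The other half pays for the error \<open>2 * B * T * M\<close>
    once \<open>T\<close> exceeds the second entry of \<open>N0\<close>; the first entry keeps
    \<open>r\<close> above \<open>T * m / 2\<close>.\<close>
  define \<delta> where "\<delta> = min 1 (\<eta> / (2 * (M + B)\<^sup>2))"
  define N0 where "N0 = max (2 * B / m) (4 * B * M / \<eta>)"
  show thesis
  proof (rule that[of \<delta> "m / 2" "M + B" N0])
    show "\<delta> > 0" using \<eta> M B by (simp add: \<delta>_def)
    show "m / 2 > 0" "M + B > 0" using m M B by auto
    fix n j k r
    assume large: "real n \<ge> N0" and inK: "(of_int j / (real n + 1), of_int k / (real n + 1)) \<in> K"
      and r: "r = real_of_int (tower_path f (n + 1) (j + k)) - 1"
    define T where "T = real n + 1"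
    define c where "c = real_of_int (j + k)"
    define x where "x = real_of_int j / T"
    define y where "y = real_of_int k / T"
    define v where "v = \<phi> (x, y)"
    have T: "T > 0" "2 * B / m \<le> T" "4 * B * M / \<eta> \<le> T" using large by (auto simp: T_def N0_def)
    have xyK: "(x, y) \<in> K" using inK by (simp add: x_def y_def T_def)
    have xyc: "x + y = c / T" by (simp add: x_def y_def c_def add_divide_distrib)
    have v: "m \<le> v" "v \<le> M" "\<bar>c / T\<bar> \<le> S" "v = F (c / T)"
      using m(2)[OF xyK] M(2)[OF xyK] S(2)[OF xyK] by (simp_all add: v_def \<phi>_def xyc)
    have "\<bar>r + 1 - (T + 1) * F (c / (T + 1))\<bar> \<le> 3"
      using tower_path_approx[OF adm, of "n + 1" "j + k"] by (simp add: r T_def c_def F_def add.commute)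
    moreover have "\<bar>(T + 1) * F (c / (T + 1)) - (T + 1) * v\<bar> \<le> S"
    proof -
      have "\<bar>(T + 1) * F (c / (T + 1)) - (T + 1) * v\<bar> = (T + 1) * \<bar>F (c / (T + 1)) - F (c / T)\<bar>"
        unfolding v(4) right_diff_distrib[symmetric] abs_mult using T by simp
      also have "\<dots> \<le> (T + 1) * \<bar>c / (T + 1) - c / T\<bar>" using T by (intro mult_left_mono lip) auto
      also have "\<dots> = \<bar>(T + 1) * (c / (T + 1) - c / T)\<bar>" using T by (simp add: abs_mult)
      also have "(T + 1) * (c / (T + 1) - c / T) = - (c / T)"
      proof -
        have "T + 1 \<noteq> 0" "T \<noteq> 0" using T by linarith+
        then have "(T + 1) * (c / (T + 1)) = c" "(T + 1) * (c / T) = c + c / T"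
          by (simp, simp add: field_simps)
        then show ?thesis unfolding right_diff_distrib by simp
      qed
      finally show ?thesis using v(3) by simp
    qed
    moreover have "(T + 1) * v = T * v + v" by (simp add: distrib_right)
    ultimately have e: "\<bar>r - T * v\<bar> \<le> B" using v m(1) unfolding B_def by linarith
    have Tm: "B \<le> T * (m / 2)" using T(2) m(1) by (simp add: field_simps)
    have "T * m \<le> T * v" "T * v \<le> T * M" using v T by (auto intro: mult_left_mono)
    moreover have "T * (m / 2) = T * m / 2" by simp
    ultimately have lower: "T * (m / 2) \<le> r" using e Tm by linarith
    have "1 \<le> T" by (simp add: T_def)
    then have "B \<le> T * B" using B mult_right_mono[of 1 T B] by simp
    then have upper: "r \<le> T * M + T * B" "T * v - B \<ge> 0" using e \<open>T * v \<le> T * M\<close> lower Tm \<open>T * m \<le> T * v\<close> \<open>T * (m / 2) = _\<close> by linarith+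
    have "0 \<le> r" using lower Tm B by linarith
    have sq: "(T * v)\<^sup>2 - 2 * B * (T * M) \<le> r\<^sup>2"
    proof -
      have "(T * v - B)\<^sup>2 \<le> r\<^sup>2" using upper(2) e by (intro power_mono) linarith+
      moreover have "(T * v - B)\<^sup>2 = (T * v)\<^sup>2 - 2 * B * (T * v) + B\<^sup>2" by (simp add: power2_diff)
      moreover have "2 * B * (T * v) \<le> 2 * B * (T * M)" using B by (intro mult_left_mono[OF \<open>T * v \<le> T * M\<close>]) simp
      moreover have "0 \<le> B\<^sup>2" by simp
      ultimately show ?thesis by linarith
    qed
    have "\<delta> * r\<^sup>2 \<le> \<eta> / (2 * (M + B)\<^sup>2) * (T * (M + B))\<^sup>2"
    proof (intro mult_mono power_mono)
      show "r \<le> T * (M + B)" using upper(1) by (simp add: distrib_left)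
    qed (use \<open>0 \<le> r\<close> \<eta> M B in \<open>auto simp: \<delta>_def\<close>)
    also have "\<dots> = \<eta> / 2 * T\<^sup>2"
    proof -
      have "M + B \<noteq> 0" using M B by linarith
      then show ?thesis by (simp add: power_mult_distrib)
    qed
    finally have d: "\<delta> * r\<^sup>2 \<le> \<eta> / 2 * T\<^sup>2" .
    have "2 * B * (T * M) \<le> \<eta> / 2 * T\<^sup>2"
    proof -
      have "4 * B * M \<le> T * \<eta>" using T(3) \<eta>(1) by (simp add: field_simps)
      then have "T * (4 * B * M) \<le> T * (T * \<eta>)" using T by (intro mult_left_mono) auto
      then show ?thesis by (simp add: power2_eq_square mult_ac)
    qed
    then have "(T * v)\<^sup>2 - \<eta> * T\<^sup>2 \<le> (1 - \<delta>) * r\<^sup>2" using sq d by (simp add: algebra_simps)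
    moreover have "2 * ((of_int j)\<^sup>2 + (of_int k)\<^sup>2) \<le> (T * v)\<^sup>2 - \<eta> * T\<^sup>2"
    proof -
      have "2 * (x\<^sup>2 + y\<^sup>2) \<le> v\<^sup>2 - \<eta>" using \<eta>(2)[OF xyK] by (simp add: h_def v_def)
      then have "T\<^sup>2 * (2 * (x\<^sup>2 + y\<^sup>2)) \<le> T\<^sup>2 * (v\<^sup>2 - \<eta>)" by (intro mult_left_mono) auto
      moreover have "of_int j = T * x" "of_int k = T * y" using T by (simp_all add: x_def y_def)
      ultimately show ?thesis by (simp add: power_mult_distrib algebra_simps)
    qed
    ultimately have "2 * ((of_int j)\<^sup>2 + (of_int k)\<^sup>2) \<le> (1 - \<delta>) * r\<^sup>2" by linarith
    then show "m / 2 * (real n + 1) \<le> r \<and> r \<le> (M + B) * (real n + 1) \<and>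
       2 * ((of_int j)\<^sup>2 + (of_int k)\<^sup>2) \<le> (1 - \<delta>) * r\<^sup>2"
      using lower upper(1) unfolding T_def[symmetric] by (simp add: algebra_simps)
  qed
qed

section \<open>Assembling the estimate\<close>

text \<open>Parity makes the two halves integers, and the disk condition bounds
  \<open>\<bar>j + k\<bar>\<close> and \<open>\<bar>j - k\<bar>\<close> by \<open>N\<close>, so they
  are nonnegative.\<close>

lemma face_coordinates:
  fixes j k r :: int
  assumes "odd (r + (j + k))" "r \<ge> 1" "\<delta> \<ge> 0"
    and disk: "2 * ((of_int j)\<^sup>2 + (of_int k)\<^sup>2) \<le> (1 - \<delta>) * (of_int r - 1)\<^sup>2"
  obtains N a b where "r = int N + 1" "j = int a + int b - int N" "k = int a - int b" "in_disk \<delta> N a b"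
proof -
  define N where "N = r - 1"
  have "N \<ge> 0" using assms by (simp add: N_def)
  have "real_of_int (2 * (j\<^sup>2 + k\<^sup>2)) \<le> (1 - \<delta>) * (real_of_int N)\<^sup>2" using disk by (simp add: N_def)
  also have "\<dots> \<le> 1 * (real_of_int N)\<^sup>2" using assms(3) by (intro mult_right_mono) auto
  also have "\<dots> = real_of_int (N\<^sup>2)" by simp
  finally have "2 * (j\<^sup>2 + k\<^sup>2) \<le> N\<^sup>2" by (simp only: of_int_le_iff)
  then have "(j + k)\<^sup>2 + (j - k)\<^sup>2 \<le> N\<^sup>2" by (simp add: power2_eq_square algebra_simps)
  then have "(j + k)\<^sup>2 \<le> N\<^sup>2" "(j - k)\<^sup>2 \<le> N\<^sup>2"
    using zero_le_power2[of "j + k"] zero_le_power2[of "j - k"] by linarith+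
  then have jk: "\<bar>j + k\<bar> \<le> N" "\<bar>j - k\<bar> \<le> N"
    using \<open>N \<ge> 0\<close> abs_le_square_iff[of "j + k" N] abs_le_square_iff[of "j - k" N] by auto
  have "even (j + k + N)" using assms(1) by (simp add: N_def algebra_simps)
  then obtain A where A: "j + k + N = 2 * A" by (elim evenE)
  define B where "B = A - k"
  have B: "j - k + N = 2 * B" using A by (simp add: B_def)
  have "A \<ge> 0" "B \<ge> 0" using jk A B by linarith+
  then obtain a b where ab: "A = int a" "B = int b" by (metis zero_le_imp_eq_int)
  obtain N' where N': "N = int N'" using \<open>N \<ge> 0\<close> zero_le_imp_eq_int by blast
  have u: "2 * real a - real N' = of_int j + of_int k" "2 * real b - real N' = of_int j - of_int k"
    using A B unfolding ab N' by linarith+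
  show thesis
  proof (rule that[of N' a b])
    show "r = int N' + 1" "j = int a + int b - int N'" "k = int a - int b"
      using A B unfolding ab N' N_def[symmetric] using N' N_def B_def ab by linarith+
    have "real_of_int r - 1 = real N'" using N' N_def by linarith
    then show "in_disk \<delta> N' a b"
      using disk unfolding in_disk_def u by (simp add: power2_eq_square algebra_simps)
  qed
qed


text \<open>Every dual edge satisfies this in one of its two directions; then its start point determines
  the disk to which \<open>grid_F_bounds\<close> is applied.\<close>

definition oriented_edge :: "(real \<Rightarrow> real) \<Rightarrow> nat \<Rightarrow> int \<Rightarrow> int \<Rightarrow> int \<Rightarrow> int \<Rightarrow> bool" where
  "oriented_edge f n \<iota> \<iota>' j k \<longleftrightarrow>
     \<bar>\<iota>\<bar> + \<bar>\<iota>'\<bar> = 1 \<and>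
       tower_path f (n + 1) (j + \<iota> + (k + \<iota>')) = tower_path f (n + 1) (j + k) + 1
     \<or> (\<iota>, \<iota>') = (1, -1)"

theorem lemma5p12:
  fixes f :: "real \<Rightarrow> real" and K :: "(real \<times> real) set"
  assumes "admissible f" and "compact K" and "K \<subseteq> liquid_region f"
  shows "\<exists>(N::real) (C::real). N > 0 \<and> C > 1 \<and>
    (\<forall>(n::nat) (j::int) (k::int) (\<iota>::int) (\<iota>'::int).
       real n > N \<and> dual_edge f n \<iota> \<iota>' j k \<and> scaled_edge n \<iota> \<iota>' j k \<subseteq> K \<longrightarrow>
         1 / (real n + 1) * (1 / C) \<le> cmod (d_tower_T f n \<iota> \<iota>' j k) \<and>
         cmod (d_tower_T f n \<iota> \<iota>' j k) \<le> 1 / (real n + 1) * C)"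
proof -
  obtain \<delta> \<rho> R N1 where pos: "\<delta> > 0" "\<rho> > 0" "R > 0" and rank:
    "\<And>n j k r. real n \<ge> N1 \<Longrightarrow> (of_int j / (real n + 1), of_int k / (real n + 1)) \<in> K \<Longrightarrow>
       r = real_of_int (tower_path f (n + 1) (j + k)) - 1 \<Longrightarrow>
       \<rho> * (real n + 1) \<le> r \<and> r \<le> R * (real n + 1) \<and>
       2 * ((of_int j)\<^sup>2 + (of_int k)\<^sup>2) \<le> (1 - \<delta>) * r\<^sup>2"
    using liquid_region_compact_rank[OF assms] by blast
  obtain C N2 where C: "C > 0" and grid: "\<And>N a b z. in_disk \<delta> N a b \<Longrightarrow> real N \<ge> N2 \<Longrightarrow>
    z \<in> {grid_F (Suc N) (Suc a) (Suc b), grid_F (Suc N) (Suc a) b, grid_F (Suc N) a b,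
         grid_F (Suc N) a (Suc b), grid_F N a (Suc b)} \<Longrightarrow>
    1 / C / real N \<le> cmod (z - grid_F N a b) \<and> cmod (z - grid_F N a b) \<le> C / real N"
    using grid_F_bounds[OF pos(1)] by blast
  define N0 where "N0 = max 1 (max N1 (\<bar>N2\<bar> / \<rho>))"
  \<comment> \<open>The level of a face over \<open>K\<close> lies between \<open>\<rho> * T\<close>
    and \<open>R * T\<close>, where \<open>T = n + 1\<close>; this trades bounds in
    \<open>1 / N\<close> for bounds in \<open>1 / T\<close>.\<close>
  define D where "D = max 2 (max (C * R) (C / \<rho>))"
  note ud = tower_path_eq(2)[OF assms(1)]
  define good where "good n j k \<longleftrightarrow> (of_int j / (real n + 1), of_int k / (real n + 1)) \<in> K" for n j k
  have key: "1 / (real n + 1) * (1 / D) \<le> cmod (d_tower_T f n \<iota> \<iota>' j k) \<and>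
         cmod (d_tower_T f n \<iota> \<iota>' j k) \<le> 1 / (real n + 1) * D"
    if n: "real n > N0" and g: "good n j k" and small: "oriented_edge f n \<iota> \<iota>' j k" for n j k \<iota> \<iota>'
  proof -
    define r where "r = tower_path f (n + 1) (j + k)"
    define T where "T = real n + 1"
    have T: "T > 0" "T * \<rho> \<ge> \<bar>N2\<bar>"
      using n pos by (auto simp: T_def N0_def field_simps)
    have r: "\<rho> * T \<le> of_int r - 1" "of_int r - 1 \<le> R * T"
      "2 * ((of_int j)\<^sup>2 + (of_int k)\<^sup>2) \<le> (1 - \<delta>) * (of_int r - 1)\<^sup>2"
      using rank[of n j k "of_int r - 1"] n g by (auto simp: N0_def good_def r_def T_def)
    have "\<rho> * T > 0" using pos T by simp
    then have r1: "r \<ge> 1" using r(1) by linarith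
    have "odd (r + (j + k))" using ud by (simp add: up_down_path_def r_def)
    from face_coordinates[OF this r1 _ r(3)] pos(1)
    obtain N a b where N: "r = int N + 1" "j = int a + int b - int N" "k = int a - int b" "in_disk \<delta> N a b"
      by auto
    have NT: "\<rho> * T \<le> real N" "real N \<le> R * T" using r(1,2) by (simp_all add: N(1))
    then have N2: "real N \<ge> N2" "real N > 0" using T(2) \<open>\<rho> * T > 0\<close> by (auto simp: mult.commute)
    have "nat r = Suc N" using N(1) by simp
    then have T0: "tower_T f n j k = grid_F N a b"
      unfolding tower_T_def r_def[symmetric] by (simp only: grid_F_def N(2,3))
    \<comment> \<open>A rise of the rank leads to one of the four upper neighbours; the diagonal
      \<open>(1, -1)\<close> stays in its column, hence at the same rank.\<close>
    have "tower_T f n (j + \<iota>) (k + \<iota>') \<in> {grid_F (Suc N) (Suc a) (Suc b), grid_F (Suc N) (Suc a) b, grid_F (Suc N) a b,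
         grid_F (Suc N) a (Suc b), grid_F N a (Suc b)}"
      using small unfolding oriented_edge_def
    proof
      assume s: "\<bar>\<iota>\<bar> + \<bar>\<iota>'\<bar> = 1 \<and>
       tower_path f (n + 1) (j + \<iota> + (k + \<iota>')) = tower_path f (n + 1) (j + k) + 1"
      then have "nat (tower_path f (n + 1) (j + \<iota> + (k + \<iota>'))) = Suc (Suc N)"
        using N(1) by (simp add: r_def)
      then have t: "tower_T f n (j + \<iota>) (k + \<iota>') = aztec_F (j + \<iota>) (k + \<iota>') (Suc (Suc N))"
        by (simp add: tower_T_def)
      from s consider "\<iota> = 1" "\<iota>' = 0" | "\<iota> = -1" "\<iota>' = 0" | "\<iota> = 0" "\<iota>' = 1" | "\<iota> = 0" "\<iota>' = -1" by linarith
      then show ?thesis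
        unfolding t by cases (simp_all add: N(2,3) grid_F_def algebra_simps del: aztec_F.simps)
    next
      assume "(\<iota>, \<iota>') = (1, -1)"
      then have t: "tower_T f n (j + \<iota>) (k + \<iota>') = aztec_F (j + 1) (k - 1) (Suc N)"
        using \<open>nat r = Suc N\<close> by (simp add: tower_T_def r_def)
      show ?thesis unfolding t by (simp add: grid_F_def N(2,3) algebra_simps del: aztec_F.simps)
    qed
    then have B: "1 / C / real N \<le> cmod (d_tower_T f n \<iota> \<iota>' j k)"
      "cmod (d_tower_T f n \<iota> \<iota>' j k) \<le> C / real N"
      using grid[OF N(4) N2(1)] unfolding d_tower_T_def T0 by auto
    have "C / real N \<le> C / (\<rho> * T)" using C NT(1) \<open>\<rho> * T > 0\<close> by (intro divide_left_mono) auto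
    also have "\<dots> = 1 / T * (C / \<rho>)" by simp
    also have "\<dots> \<le> 1 / T * D" using T by (intro mult_left_mono) (auto simp: D_def)
    finally have upper: "C / real N \<le> 1 / T * D" .
    have "1 / T * (1 / D) \<le> 1 / T * (1 / (C * R))"
      using T C pos by (intro mult_left_mono divide_left_mono) (auto simp: D_def)
    also have "\<dots> = 1 / C / (R * T)" by simp
    also have "\<dots> \<le> 1 / C / real N" using NT(2) N2 C pos T by (intro divide_left_mono) auto
    finally show ?thesis using upper B unfolding T_def by linarith
  qed
  show ?thesis
  proof (intro exI conjI allI impI)
    show "N0 > 0" "D > 1" by (auto simp: N0_def D_def)
    fix n j k \<iota> \<iota>'
    assume A: "real n > N0 \<and> dual_edge f n \<iota> \<iota>' j k \<and> scaled_edge n \<iota> \<iota>' j k \<subseteq> K"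
    then have "(1 / (real n + 1)) *\<^sub>R (of_int j, of_int k) \<in> K"
      "(1 / (real n + 1)) *\<^sub>R (of_int (j + \<iota>), of_int (k + \<iota>')) \<in> K"
      unfolding scaled_edge_def by (meson ends_in_segment subsetD)+
    then have g: "good n j k" "good n (j + \<iota>) (k + \<iota>')"
      by (simp_all add: good_def scaleR_prod_def)
    have rev: "d_tower_T f n (- \<iota>) (- \<iota>') (j + \<iota>) (k + \<iota>') = - d_tower_T f n \<iota> \<iota>' j k"
      by (simp add: d_tower_T_def)
    have step: "H (c + 1) - H c = 1 \<or> H (c + 1) - H c = - 1" if "H = tower_path f (n + 1)" for H c
      using ud that by (simp add: up_down_path_def)
    from A have "(\<iota>, \<iota>') \<in> {(1, 0), (-1, 0), (0, 1), (0, -1), (1, -1), (-1, 1)}"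
      by (auto simp: dual_edge_def)
    \<comment> \<open>Along an axis edge \<open>j + k\<close> changes by one, and so does the rank;
      if it falls, it rises along the reversed edge. The diagonal \<open>(-1, 1)\<close> is the
      reverse of \<open>(1, -1)\<close>. Both ends lie over \<open>K\<close>, so \<open>key\<close>
      applies at either.\<close>
    then have "oriented_edge f n \<iota> \<iota>' j k \<or> oriented_edge f n (- \<iota>) (- \<iota>') (j + \<iota>) (k + \<iota>')"
      using step[of _ "j + k", OF refl] step[of _ "j + k - 1", OF refl]
      by (auto simp: oriented_edge_def algebra_simps)
    then show "1 / (real n + 1) * (1 / D) \<le> cmod (d_tower_T f n \<iota> \<iota>' j k)"
      "cmod (d_tower_T f n \<iota> \<iota>' j k) \<le> 1 / (real n + 1) * D"
      using key[of n j k \<iota> \<iota>'] key[of n "j + \<iota>" "k + \<iota>'" "- \<iota>" "- \<iota>'"] g A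
      unfolding rev norm_minus_cancel by blast+
  qed
qed

end
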